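(* Let $\mathcal{Z}_{\mathrm{simple}} = \{q \in \mathbb{C} : \operatorname{Rel}(G;q) = 0 \text{ for some connected simple graph } G\}$ and let $\mathbb{D}$ denote the open unit disk in $\mathbb{C}$. Then: (1) $\overline{\mathbb{D}} \subseteq \overline{\mathcal{Z}_{\mathrm{simple}}}$, i.e. reliability roots of simple graphs are dense in the unit disk. (2) $\mathcal{Z}_{\mathrm{simple}} \cap \mathbb{R}$ is dense in $[-1,0]$, and consequently $\overline{\mathcal{Z}_{\mathrm{simple}} \cap \mathbb{R}} = [-1,0] \cup \{1\}$.
   Context: For a connected (multi)graph $G=(V,E)$, the (all-terminal) reliability polynomial is $\operatorname{Rel}(G;q) = \sum_{S \subseteq E,\ (V,S)\text{ connected}} (1-q)^{|S|} q^{|E|-|S|}$, a polynomial in $q$. A reliability root of $G$ is a complex zero of this polynomial. Overlines denote topological closure in $\mathbb{C}$. *)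

theory Defs
  imports "HOL-Analysis.Analysis" "HOL-Computational_Algebra.Polynomial"
begin

text \<open>A finite simple graph is given by its vertex set and its edge set, an edge being the
  two-element set of its endpoints.\<close>

definition simple_graph :: "'a set \<Rightarrow> 'a set set \<Rightarrow> bool" where
  "simple_graph V E \<longleftrightarrow> finite V \<and> (\<forall>e\<in>E. e \<subseteq> V \<and> card e = 2)"

text \<open>The null graph (without vertices) does not count as connected.\<close>

definition connected_graph :: "'a set \<Rightarrow> 'a set set \<Rightarrow> bool" where
  "connected_graph V E \<longleftrightarrow> V \<noteq> {} \<and> (\<forall>u\<in>V. \<forall>v\<in>V. (u, v) \<in> {(x, y). {x, y} \<in> E}\<^sup>*)"

text \<open>In the indeterminate \<open>q\<close>, \<open>[:1, -1:]\<close> is \<open>1 - q\<close> and \<open>[:0, 1:]\<close> is \<open>q\<close>.\<close>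

definition rel_poly :: "'a set \<Rightarrow> 'a set set \<Rightarrow> complex poly" where
  "rel_poly V E =
    (\<Sum>S | S \<subseteq> E \<and> connected_graph V S. [:1, -1:] ^ card S * [:0, 1:] ^ (card E - card S))"

text \<open>Every finite graph is isomorphic to one whose vertices are natural numbers.\<close>

definition Z_simple :: "complex set" where
  "Z_simple = {q. \<exists>(V :: nat set) E.
     simple_graph V E \<and> connected_graph V E \<and> poly (rel_poly V E) q = 0}"

end

theory Submission
  imports Defs "HOL-Complex_Analysis.Great_Picard"
begin

text \<open>
  \<open>Rel(G; q)\<close> is, formally, the probability that \<open>G\<close> stays connected when each edge fails
  independently with probability \<open>q\<close>; let \<open>split(G; q)\<close> be the probability that the surviving
  edges leave two components, one around each of two terminals.

  Real roots: let \<open>A\<close> be the component of a vertex \<open>s\<close> after deleting another vertex \<open>t\<close>. Summing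
  over \<open>A\<close> gives \<open>Rel(G) = \<Sum> Rel(G[A]) (1 - q ^ n) q ^ e Rel(G[V - A])\<close>, where \<open>A\<close> sends \<open>n\<close>
  edges to \<open>t\<close> and \<open>e\<close> edges to \<open>V - A - {t}\<close>. For real \<open>q\<close> with \<open>\<bar>q\<bar> > 1\<close> it follows by induction
  that \<open>(- 1) ^ (card V + 1) q ^ card E Rel(G; q) > 0\<close>, since \<open>q ^ n (q ^ n - 1) > 0\<close> for \<open>n > 0\<close>.

  Density: a cycle of \<open>N + 1\<close> bundles of \<open>k\<close> parallel edges has the factor \<open>1 + N q ^ k\<close> in its
  reliability, and the zeros of these factors are dense in the unit disk (for odd \<open>k\<close>, the real
  ones are dense in \<open>[-1, 0]\<close>). To make the graph simple, each edge is put in series with a large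
  clique. Inside the unit disk \<open>Rel\<close> tends to \<open>1\<close> and \<open>split\<close> to \<open>0\<close> as the clique grows, so the
  clique behaves like a single vertex and the corresponding factor converges to \<open>1 + N q ^ k\<close>
  locally uniformly. Hurwitz's theorem (the intermediate value theorem for real roots) gives zeros
  nearby.
\<close>

subsection \<open>Connectedness, cuts and components\<close>

definition uncut :: "'a set set \<Rightarrow> 'a set \<Rightarrow> bool" where
  "uncut S U \<longleftrightarrow> (\<forall>x y. {x, y} \<in> S \<longrightarrow> (x \<in> U \<longleftrightarrow> y \<in> U))"

lemma uncutD: "uncut S U \<Longrightarrow> {x, y} \<in> S \<Longrightarrow> x \<in> U \<longleftrightarrow> y \<in> U"
  by (auto simp: uncut_def)

lemma uncut_Un: "uncut (S \<union> T) U \<longleftrightarrow> uncut S U \<and> uncut T U"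
  by (auto simp: uncut_def)

lemma uncut_insert: "uncut (insert {s, t} S) U \<longleftrightarrow> (s \<in> U \<longleftrightarrow> t \<in> U) \<and> uncut S U"
  by (auto simp: uncut_def doubleton_eq_iff)

lemma uncut_Compl: "uncut S (- U) \<longleftrightarrow> uncut S U"
  by (auto simp: uncut_def)

lemma uncut_subset: "uncut S U \<Longrightarrow> T \<subseteq> S \<Longrightarrow> uncut T U"
  by (auto simp: uncut_def)

lemma uncut_Int_Pow:
  assumes "S \<subseteq> Pow V"
  shows "uncut S (U \<inter> V) \<longleftrightarrow> uncut S U"
proof -
  have "x \<in> V \<and> y \<in> V" if "{x, y} \<in> S" for x y using assms that by auto
  then show ?thesis unfolding uncut_def by (metis Int_iff)
qed

lemma uncut_trivial: "S \<subseteq> Pow V \<Longrightarrow> V \<subseteq> U \<or> V \<inter> U = {} \<Longrightarrow> uncut S U"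
  unfolding uncut_def by blast

lemma uncut_glue:
  assumes S: "S1 \<subseteq> Pow V1" "S2 \<subseteq> Pow V2" and U: "uncut S1 U1" "uncut S2 U2"
    and agree: "U1 \<inter> (V1 \<inter> V2) = U2 \<inter> (V1 \<inter> V2)"
  shows "uncut (S1 \<union> S2) (U1 \<inter> V1 \<union> U2 \<inter> V2)" (is "uncut _ ?U")
proof -
  have "?U \<inter> V1 = U1 \<inter> V1" "?U \<inter> V2 = U2 \<inter> V2" using agree by auto
  then show ?thesis using S U uncut_Int_Pow unfolding uncut_Un by metis
qed

definition linked :: "'a set set \<Rightarrow> 'a \<Rightarrow> 'a \<Rightarrow> bool" where
  "linked S x y \<longleftrightarrow> (\<forall>U. uncut S U \<longrightarrow> (x \<in> U \<longleftrightarrow> y \<in> U))"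

lemma linked_refl: "linked S x x"
  by (simp add: linked_def)

lemma linked_mono: "linked S x y \<Longrightarrow> S \<subseteq> T \<Longrightarrow> linked T x y"
  unfolding linked_def by (metis uncut_subset)

lemma not_linkedE:
  assumes "\<not> linked S x y"
  obtains U where "uncut S U" "x \<in> U" "y \<notin> U"
  using assms uncut_Compl[of S] unfolding linked_def by (metis ComplI ComplD)

lemma linked_iff_rtrancl: "linked S x y \<longleftrightarrow> (x, y) \<in> {(x, y). {x, y} \<in> S}\<^sup>*"
proof
  let ?U = "{z. (x, z) \<in> {(x, y). {x, y} \<in> S}\<^sup>*}"
  assume "linked S x y"
  moreover have "uncut S ?U"
    unfolding uncut_def by (auto intro: rtrancl_into_rtrancl simp: insert_commute)
  ultimately show "(x, y) \<in> {(x, y). {x, y} \<in> S}\<^sup>*" unfolding linked_def by blast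
next
  assume "(x, y) \<in> {(x, y). {x, y} \<in> S}\<^sup>*"
  then show "linked S x y"
    by (induction rule: rtrancl_induct) (auto simp: linked_def dest: uncutD)
qed

lemma connected_graph_iff_linked:
  "connected_graph V S \<longleftrightarrow> V \<noteq> {} \<and> (\<forall>x\<in>V. \<forall>y\<in>V. linked S x y)"
  by (simp add: connected_graph_def linked_iff_rtrancl)

lemma connected_graph_iff_uncut:
  "connected_graph V S \<longleftrightarrow> V \<noteq> {} \<and> (\<forall>U. uncut S U \<longrightarrow> V \<subseteq> U \<or> V \<inter> U = {})"
  unfolding connected_graph_iff_linked linked_def by blast

lemma connected_graph_uncut: "connected_graph V S \<Longrightarrow> uncut S U \<Longrightarrow> V \<subseteq> U \<or> V \<inter> U = {}"
  by (simp add: connected_graph_iff_uncut)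

lemma connected_graph_mono: "connected_graph V S \<Longrightarrow> S \<subseteq> T \<Longrightarrow> connected_graph V T"
  unfolding connected_graph_iff_uncut by (meson uncut_subset)

lemma connected_graph_insert_edge:
  assumes "s \<in> V" "t \<in> V"
  shows "connected_graph V S \<longleftrightarrow> connected_graph V (insert {s, t} S) \<and> linked S s t"
proof
  assume "connected_graph V S"
  then show "connected_graph V (insert {s, t} S) \<and> linked S s t"
    using assms connected_graph_mono[of V S "insert {s, t} S"]
    by (auto simp: connected_graph_iff_linked)
qed (auto simp: connected_graph_iff_uncut uncut_insert linked_def)

lemma connected_graph_Un:
  assumes "connected_graph V1 S1" "connected_graph V2 S2" "V1 \<inter> V2 \<noteq> {}"
  shows "connected_graph (V1 \<union> V2) (S1 \<union> S2)"
  unfolding connected_graph_iff_uncut uncut_Un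
proof (intro conjI allI impI)
  fix U assume "uncut S1 U \<and> uncut S2 U"
  then have "V1 \<subseteq> U \<or> V1 \<inter> U = {}" "V2 \<subseteq> U \<or> V2 \<inter> U = {}"
    using assms connected_graph_uncut by blast+
  then show "V1 \<union> V2 \<subseteq> U \<or> (V1 \<union> V2) \<inter> U = {}" using assms(3) by blast
qed (use assms(3) in auto)

lemma connected_graph_Un_left:
  assumes conn: "connected_graph (V1 \<union> V2) (S1 \<union> S2)" and S: "S1 \<subseteq> Pow V1" "S2 \<subseteq> Pow V2"
    and overlap: "V1 \<inter> V2 \<noteq> {}" "\<And>x y. x \<in> V1 \<inter> V2 \<Longrightarrow> y \<in> V1 \<inter> V2 \<Longrightarrow> linked S1 x y"
  shows "connected_graph V1 S1"
  unfolding connected_graph_iff_uncut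
proof (intro conjI allI impI)
  fix U assume U: "uncut S1 U"
  obtain u where u: "u \<in> V1 \<inter> V2" using overlap(1) by blast
  define W where "W = (if u \<in> U then V2 else {})"
  have "x \<in> U \<longleftrightarrow> u \<in> U" if "x \<in> V1 \<inter> V2" for x
    using overlap(2)[OF that u] U by (auto simp: linked_def)
  then have agree: "U \<inter> (V1 \<inter> V2) = W \<inter> (V1 \<inter> V2)" by (auto simp: W_def)
  have "uncut S2 W" using S(2) by (intro uncut_trivial[of S2 V2]) (auto simp: W_def)
  from connected_graph_uncut[OF conn uncut_glue[OF S U this agree]]
  have "V1 \<subseteq> U \<inter> V1 \<union> W \<inter> V2 \<or> V1 \<inter> (U \<inter> V1 \<union> W \<inter> V2) = {}" by blast
  moreover have "(U \<inter> V1 \<union> W \<inter> V2) \<inter> V1 = U \<inter> V1" using agree by blast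
  ultimately show "V1 \<subseteq> U \<or> V1 \<inter> U = {}" by blast
qed (use overlap(1) in auto)

lemma connected_single_edge: "connected_graph {s, t} {{s, t}}"
  by (auto simp: connected_graph_iff_uncut uncut_insert)

lemma connected_graph_one_vertex_union:
  assumes "V1 \<inter> V2 = {u}" "S1 \<subseteq> Pow V1" "S2 \<subseteq> Pow V2"
  shows "connected_graph (V1 \<union> V2) (S1 \<union> S2) \<longleftrightarrow> connected_graph V1 S1 \<and> connected_graph V2 S2"
proof
  assume "connected_graph (V1 \<union> V2) (S1 \<union> S2)"
  then show "connected_graph V1 S1 \<and> connected_graph V2 S2"
    using connected_graph_Un_left[of V1 V2 S1 S2] connected_graph_Un_left[of V2 V1 S2 S1] assms
    by (simp add: Un_commute Int_commute linked_refl)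
qed (use assms(1) connected_graph_Un[of V1 S1 V2 S2] in simp)

lemma connected_graph_add_vertex:
  assumes A: "connected_graph A S" "S \<subseteq> Pow A" "t \<notin> A" and N: "N \<subseteq> (\<lambda>a. {a, t}) ` A"
  shows "connected_graph (insert t A) (S \<union> N) \<longleftrightarrow> N \<noteq> {}"
proof
  assume "N \<noteq> {}"
  then obtain a where a: "a \<in> A" "{a, t} \<in> N" using N by blast
  have "connected_graph ({a, t} \<union> A) ({{a, t}} \<union> S)"
    using A(1) a(1) by (intro connected_graph_Un connected_single_edge) auto
  moreover have "{a, t} \<union> A = insert t A" using a(1) by auto
  ultimately show "connected_graph (insert t A) (S \<union> N)"
    using connected_graph_mono[of "insert t A" "{{a, t}} \<union> S"] a(2) by simp
next
  have "uncut S A" by (rule uncut_trivial[OF A(2)]) simp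
  moreover have "A \<noteq> {}" using A(1) by (simp add: connected_graph_def)
  ultimately show "connected_graph (insert t A) (S \<union> N) \<Longrightarrow> N \<noteq> {}"
    using connected_graph_uncut[of "insert t A" S A] A(3) by auto
qed

lemma connected_graph_image:
  assumes "connected_graph V S"
  shows "connected_graph (f ` V) ((`) f ` S)"
  unfolding connected_graph_iff_uncut
proof (intro conjI allI impI)
  show "f ` V \<noteq> {}" using assms by (simp add: connected_graph_def)
  fix U assume U: "uncut ((`) f ` S) U"
  have "uncut S (f -` U)"
    unfolding uncut_def
  proof (intro allI impI)
    fix x y assume "{x, y} \<in> S"
    then have "f ` {x, y} \<in> (`) f ` S" by (rule imageI)
    then show "x \<in> f -` U \<longleftrightarrow> y \<in> f -` U" using uncutD[OF U, of "f x" "f y"] by simp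
  qed
  then show "f ` V \<subseteq> U \<or> f ` V \<inter> U = {}" using connected_graph_uncut[OF assms] by blast
qed

lemma connected_graph_image_iff:
  assumes "inj_on f V" "S \<subseteq> Pow V"
  shows "connected_graph (f ` V) ((`) f ` S) \<longleftrightarrow> connected_graph V S"
proof
  let ?g = "inv_into V f"
  assume "connected_graph (f ` V) ((`) f ` S)"
  then have "connected_graph (?g ` f ` V) ((`) ?g ` (`) f ` S)" by (rule connected_graph_image)
  moreover have id: "?g ` f ` A = A" if "A \<subseteq> V" for A
    using inv_into_image_cancel[OF assms(1) that] .
  have "(`) ?g ` (`) f ` S = (\<lambda>A. A) ` S"
    unfolding image_image[of "(`) ?g"] by (rule image_cong[OF refl]) (use id assms(2) in auto)
  ultimately show "connected_graph V S" using id[of V] by simp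
qed (rule connected_graph_image)

definition component :: "'a set set \<Rightarrow> 'a \<Rightarrow> 'a set" where
  "component S r = {v. linked S r v}"

lemma component_subset:
  assumes "S \<subseteq> Pow V" "r \<in> V"
  shows "component S r \<subseteq> V"
  using assms uncut_trivial[OF assms(1), of V] by (auto simp: component_def linked_def)

lemma uncut_component: "uncut S (component S r)"
  unfolding uncut_def component_def linked_def by blast

lemma connected_component: "connected_graph (component S r) (S \<inter> Pow (component S r))"
  unfolding connected_graph_iff_uncut
proof (intro conjI allI impI)
  let ?A = "component S r"
  have r: "r \<in> ?A" by (simp add: component_def linked_refl)
  then show "?A \<noteq> {}" by blast
  fix U assume "uncut (S \<inter> Pow ?A) U"
  then have "uncut S (?A \<inter> U)" "uncut S (?A - U)"
    using uncut_component[of S r] unfolding uncut_def by auto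
  moreover have least: "?A \<subseteq> W" if "uncut S W" "r \<in> W" for W
    using that by (auto simp: component_def linked_def)
  ultimately show "?A \<subseteq> U \<or> ?A \<inter> U = {}"
    using r least[of "?A \<inter> U"] least[of "?A - U"] by auto
qed

lemma component_eq_iff:
  assumes "r \<in> A"
  shows "component S r = A \<longleftrightarrow> uncut S A \<and> connected_graph A (S \<inter> Pow A)"
proof
  show "uncut S A \<and> connected_graph A (S \<inter> Pow A)" if "component S r = A"
    using that uncut_component[of S r] connected_component[of S r] by simp
  assume A: "uncut S A \<and> connected_graph A (S \<inter> Pow A)"
  show "component S r = A"
  proof
    show "component S r \<subseteq> A" using A assms by (auto simp: component_def linked_def)
    have "linked (S \<inter> Pow A) r v" if "v \<in> A" for v
      using A assms that by (simp add: connected_graph_iff_linked)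
    then show "A \<subseteq> component S r"
      using linked_mono[of "S \<inter> Pow A" r _ S] by (auto simp: component_def)
  qed
qed

subsection \<open>Gluing graphs at one or two vertices\<close>

abbreviation splits :: "'a set \<Rightarrow> 'a \<Rightarrow> 'a \<Rightarrow> 'a set set \<Rightarrow> bool" where
  "splits V s t S \<equiv> connected_graph V (insert {s, t} S) \<and> \<not> connected_graph V S"

lemma splits_iff_not_linked:
  assumes "s \<in> V" "t \<in> V"
  shows "splits V s t S \<longleftrightarrow> connected_graph V (insert {s, t} S) \<and> \<not> linked S s t"
  using connected_graph_insert_edge[OF assms] by blast

lemma connected_parallel:
  assumes V: "V1 \<inter> V2 = {s, t}" and S: "S1 \<subseteq> Pow V1" "S2 \<subseteq> Pow V2"
  shows "connected_graph (V1 \<union> V2) (insert {s, t} (S1 \<union> S2)) \<longleftrightarrow>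
    connected_graph V1 (insert {s, t} S1) \<and> connected_graph V2 (insert {s, t} S2)"
    (is "?C \<longleftrightarrow> ?C1 \<and> ?C2")
proof
  have Un: "insert {s, t} S1 \<union> insert {s, t} S2 = insert {s, t} (S1 \<union> S2)" by blast
  have sub: "insert {s, t} S1 \<subseteq> Pow V1" "insert {s, t} S2 \<subseteq> Pow V2" using V S by auto
  have linked: "linked (insert {s, t} S) x y" if "x \<in> {s, t}" "y \<in> {s, t}" for S x y
    using that by (auto simp: linked_def uncut_insert)
  show "?C1 \<and> ?C2" if ?C
    using connected_graph_Un_left[OF _ sub] connected_graph_Un_left[OF _ sub(2,1)] that V linked Un
    by (simp add: Un_commute Int_commute)
  show ?C if "?C1 \<and> ?C2"
    using connected_graph_Un[of V1 "insert {s, t} S1" V2 "insert {s, t} S2"] that V Un by simp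
qed

lemma linked_parallel:
  assumes V: "V1 \<inter> V2 = {s, t}" and S: "S1 \<subseteq> Pow V1" "S2 \<subseteq> Pow V2"
  shows "linked (S1 \<union> S2) s t \<longleftrightarrow> linked S1 s t \<or> linked S2 s t"
proof
  show "linked S1 s t \<or> linked S2 s t" if linked: "linked (S1 \<union> S2) s t"
  proof (rule ccontr)
    assume "\<not> (linked S1 s t \<or> linked S2 s t)"
    then obtain U1 U2 where U: "uncut S1 U1" "s \<in> U1" "t \<notin> U1" "uncut S2 U2" "s \<in> U2" "t \<notin> U2"
      by (meson not_linkedE)
    have "uncut (S1 \<union> S2) (U1 \<inter> V1 \<union> U2 \<inter> V2)" using S U V by (intro uncut_glue) auto
    then show False using linked U V unfolding linked_def by blast
  qed
qed (auto simp: linked_def uncut_Un)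

lemma splits_parallel:
  assumes V: "V1 \<inter> V2 = {s, t}" and S: "S1 \<subseteq> Pow V1" "S2 \<subseteq> Pow V2"
  shows "splits (V1 \<union> V2) s t (S1 \<union> S2) \<longleftrightarrow> splits V1 s t S1 \<and> splits V2 s t S2"
proof -
  have st: "s \<in> V1" "t \<in> V1" "s \<in> V2" "t \<in> V2" using V by auto
  then have "splits (V1 \<union> V2) s t (S1 \<union> S2) \<longleftrightarrow>
      connected_graph (V1 \<union> V2) (insert {s, t} (S1 \<union> S2)) \<and> \<not> linked (S1 \<union> S2) s t"
    by (intro splits_iff_not_linked) auto
  then show ?thesis
    unfolding connected_parallel[OF assms] linked_parallel[OF assms]
      splits_iff_not_linked[OF st(1,2)] splits_iff_not_linked[OF st(3,4)] by blast
qed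

lemma linked_series:
  assumes V: "V1 \<inter> V2 = {u}" "s \<in> V1" "t \<in> V2" and S: "S1 \<subseteq> Pow V1" "S2 \<subseteq> Pow V2"
    and conn: "connected_graph (V1 \<union> V2) (insert {s, t} (S1 \<union> S2))"
  shows "linked S1 u s \<or> linked S2 u t"
proof (rule ccontr)
  assume "\<not> (linked S1 u s \<or> linked S2 u t)"
  then obtain U1 U2 where U: "uncut S1 U1" "u \<in> U1" "s \<notin> U1" "uncut S2 U2" "u \<in> U2" "t \<notin> U2"
    by (meson not_linkedE)
  let ?W = "U1 \<inter> V1 \<union> U2 \<inter> V2"
  have st: "s \<notin> ?W" "t \<notin> ?W" using U V by auto
  have "uncut (S1 \<union> S2) ?W" using S U V by (intro uncut_glue) auto
  with st have "uncut (insert {s, t} (S1 \<union> S2)) ?W" by (simp only: uncut_insert)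
  then have "V1 \<union> V2 \<subseteq> ?W \<or> (V1 \<union> V2) \<inter> ?W = {}" by (rule connected_graph_uncut[OF conn])
  moreover have "u \<in> (V1 \<union> V2) \<inter> ?W" using V(1) U(2) by auto
  ultimately show False using st V(2) by blast
qed

lemma connected_insert_series:
  assumes V: "V1 \<inter> V2 = {u}" "s \<in> V1" "t \<in> V2" and S: "S1 \<subseteq> Pow V1" "S2 \<subseteq> Pow V2"
  shows "connected_graph (V1 \<union> V2) (insert {s, t} (S1 \<union> S2)) \<longleftrightarrow>
    connected_graph V1 (insert {s, u} S1) \<and> connected_graph V2 (insert {u, t} S2) \<and>
    (connected_graph V1 S1 \<or> connected_graph V2 S2)"
    (is "?C \<longleftrightarrow> ?J1 \<and> ?J2 \<and> (?C1 \<or> ?C2)")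
proof
  have u: "u \<in> V1" "u \<in> V2" using V by auto
  have both: "connected_graph (V1 \<union> V2) (insert {s, u} S1 \<union> insert {u, t} S2) \<longleftrightarrow> ?J1 \<and> ?J2"
    using V S u by (intro connected_graph_one_vertex_union) auto
  have uncut_both: "uncut (insert {s, u} S1 \<union> insert {u, t} S2) U \<longleftrightarrow>
      uncut (insert {s, t} (S1 \<union> S2)) U \<and> (s \<in> U \<longleftrightarrow> u \<in> U)" for U
    by (auto simp: uncut_Un uncut_insert)
  show "?J1 \<and> ?J2 \<and> (?C1 \<or> ?C2)" if C: ?C
  proof -
    have "?J1 \<and> ?J2"
      using C unfolding both[symmetric] unfolding connected_graph_iff_uncut uncut_both by blast
    moreover have "linked S1 s u \<or> linked S2 u t"
      using linked_series[OF assms C] by (auto simp: linked_def)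
    ultimately show ?thesis
      using connected_graph_insert_edge[OF V(2) u(1)] connected_graph_insert_edge[OF u(2) V(3)]
      by blast
  qed
  show ?C if J: "?J1 \<and> ?J2 \<and> (?C1 \<or> ?C2)"
  proof -
    have "s \<in> U \<longleftrightarrow> u \<in> U" if U: "uncut (insert {s, t} (S1 \<union> S2)) U" for U
    proof -
      have "s \<in> U \<longleftrightarrow> t \<in> U" "V1 \<subseteq> U \<or> V1 \<inter> U = {} \<or> V2 \<subseteq> U \<or> V2 \<inter> U = {}"
        using U J connected_graph_uncut by (auto simp: uncut_insert uncut_Un)
      then show ?thesis using u V by blast
    qed
    moreover have "connected_graph (V1 \<union> V2) (insert {s, u} S1 \<union> insert {u, t} S2)"
      using J both by blast
    ultimately show ?thesis unfolding connected_graph_iff_uncut uncut_both by blast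
  qed
qed

lemma splits_series:
  assumes V: "V1 \<inter> V2 = {u}" "s \<in> V1" "t \<in> V2" and S: "S1 \<subseteq> Pow V1" "S2 \<subseteq> Pow V2"
  shows "splits (V1 \<union> V2) s t (S1 \<union> S2) \<longleftrightarrow>
    connected_graph V1 S1 \<and> splits V2 u t S2 \<or> splits V1 s u S1 \<and> connected_graph V2 S2"
  using connected_insert_series[OF assms] connected_graph_one_vertex_union[OF V(1) S]
    connected_graph_mono[of V1 S1 "insert {s, u} S1"]
    connected_graph_mono[of V2 S2 "insert {u, t} S2"]
  by blast

subsection \<open>Random edge sets\<close>

text \<open>Formally the probability that the set of surviving elements satisfies \<open>Q\<close>, if each element
  of \<open>E\<close> fails independently with probability \<open>q\<close>.\<close>

definition subset_prob :: "('e set \<Rightarrow> bool) \<Rightarrow> 'e set \<Rightarrow> 'b::comm_ring_1 \<Rightarrow> 'b" where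
  "subset_prob Q E q = (\<Sum>S | S \<subseteq> E \<and> Q S. (1 - q) ^ card S * q ^ card (E - S))"

lemma subset_prob_cong:
  "E = E' \<Longrightarrow> (\<And>S. S \<subseteq> E' \<Longrightarrow> Q S \<longleftrightarrow> Q' S) \<Longrightarrow> subset_prob Q E q = subset_prob Q' E' q"
  unfolding subset_prob_def by (intro sum.cong) auto

lemma sum_Pow_power:
  fixes a b :: "'b::comm_semiring_1"
  assumes "finite E"
  shows "(\<Sum>S\<in>Pow E. a ^ card S * b ^ card (E - S)) = (a + b) ^ card E"
  using prod_add[OF assms, of "\<lambda>_. a" "\<lambda>_. b"] by simp

lemma subset_prob_True: "finite E \<Longrightarrow> subset_prob (\<lambda>_. True) E q = 1"
  using sum_Pow_power[of E "1 - q" q] by (simp add: subset_prob_def Pow_def)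

lemma subset_prob_eq_empty: "subset_prob (\<lambda>S. S = {}) E q = q ^ card E"
proof -
  have "{S. S \<subseteq> E \<and> S = {}} = {{}}" by auto
  then show ?thesis by (simp add: subset_prob_def)
qed

lemma subset_prob_disj:
  assumes "finite E" "\<And>S. S \<subseteq> E \<Longrightarrow> \<not> (Q S \<and> Q' S)"
  shows "subset_prob (\<lambda>S. Q S \<or> Q' S) E q = subset_prob Q E q + subset_prob Q' E q"
proof -
  have "{S. S \<subseteq> E \<and> (Q S \<or> Q' S)} = {S. S \<subseteq> E \<and> Q S} \<union> {S. S \<subseteq> E \<and> Q' S}" by auto
  then show ?thesis
    unfolding subset_prob_def using assms by (subst sum.union_disjoint[symmetric]) auto
qed

lemma subset_prob_not:
  assumes "finite E"
  shows "subset_prob (\<lambda>S. \<not> Q S) E q = 1 - subset_prob Q E q"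
  using subset_prob_disj[OF assms, of Q "\<lambda>S. \<not> Q S" q] subset_prob_True[OF assms, of q]
  by (simp add: algebra_simps)

lemma subset_prob_partition:
  assumes "finite E" "finite I" "\<And>S. S \<subseteq> E \<Longrightarrow> Q S \<Longrightarrow> f S \<in> I"
  shows "subset_prob Q E q = (\<Sum>i\<in>I. subset_prob (\<lambda>S. Q S \<and> f S = i) E q)"
proof -
  have "f ` {S. S \<subseteq> E \<and> Q S} \<subseteq> I" using assms(3) by auto
  from sum.group[OF _ assms(2) this, of "\<lambda>S. (1 - q) ^ card S * q ^ card (E - S)"] show ?thesis
    using assms(1) by (simp add: subset_prob_def conj_assoc)
qed

lemma subset_prob_Un:
  assumes fin: "finite E1" "finite E2" and disj: "E1 \<inter> E2 = {}"
    and Q: "\<And>S1 S2. S1 \<subseteq> E1 \<Longrightarrow> S2 \<subseteq> E2 \<Longrightarrow> Q (S1 \<union> S2) \<longleftrightarrow> Q1 S1 \<and> Q2 S2"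
  shows "subset_prob Q (E1 \<union> E2) q = subset_prob Q1 E1 q * subset_prob Q2 E2 q"
proof -
  let ?A = "{S. S \<subseteq> E1 \<and> Q1 S}" and ?B = "{S. S \<subseteq> E2 \<and> Q2 S}"
  let ?h = "\<lambda>E S. (1 - q) ^ card S * q ^ card (E - S)"
  let ?join = "\<lambda>(S1, S2). S1 \<union> S2" and ?cut = "\<lambda>S. (S \<inter> E1, S \<inter> E2)"
  have "subset_prob Q1 E1 q * subset_prob Q2 E2 q = (\<Sum>(S1, S2)\<in>?A \<times> ?B. ?h E1 S1 * ?h E2 S2)"
    unfolding subset_prob_def by (simp add: sum_product sum.cartesian_product)
  also have "\<dots> = subset_prob Q (E1 \<union> E2) q"
    unfolding subset_prob_def
  proof (rule sum.reindex_bij_witness[where i = ?cut and j = ?join])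
    fix a assume "a \<in> ?A \<times> ?B"
    then obtain S1 S2 where a: "a = (S1, S2)" and S: "S1 \<subseteq> E1" "S2 \<subseteq> E2" "Q1 S1" "Q2 S2"
      by auto
    have "E1 \<union> E2 - (S1 \<union> S2) = (E1 - S1) \<union> (E2 - S2)" using S disj by auto
    then have "card (E1 \<union> E2 - (S1 \<union> S2)) = card (E1 - S1) + card (E2 - S2)"
      "card (S1 \<union> S2) = card S1 + card S2"
      using S disj fin by (auto intro!: card_Un_disjoint intro: finite_subset)
    then show "?h (E1 \<union> E2) (?join a) = (case a of (S1, S2) \<Rightarrow> ?h E1 S1 * ?h E2 S2)"
      by (simp add: a power_add mult_ac)
    show "?cut (?join a) = a"
      using S disj by (auto simp: a)
    show "?join a \<in> {S. S \<subseteq> E1 \<union> E2 \<and> Q S}"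
      using S Q by (auto simp: a)
  next
    fix S assume "S \<in> {S. S \<subseteq> E1 \<union> E2 \<and> Q S}"
    moreover from this have S: "S \<inter> E1 \<union> S \<inter> E2 = S" by auto
    ultimately show "?cut S \<in> ?A \<times> ?B"
      using Q[of "S \<inter> E1" "S \<inter> E2"] by auto
    show "?join (?cut S) = S" using S by simp
  qed
  finally show ?thesis ..
qed

lemma subset_prob_Int:
  assumes "finite E" "F \<subseteq> E"
  shows "subset_prob (\<lambda>S. Q (S \<inter> F)) E q = subset_prob Q F q"
proof -
  have fin: "finite F" "finite (E - F)" using assms finite_subset by auto
  have "(S1 \<union> S2) \<inter> F = S1" if "S1 \<subseteq> F" "S2 \<subseteq> E - F" for S1 S2 using that by auto
  then have "subset_prob (\<lambda>S. Q (S \<inter> F)) (F \<union> (E - F)) q =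
      subset_prob Q F q * subset_prob (\<lambda>_. True) (E - F) q"
    by (intro subset_prob_Un fin) auto
  then show ?thesis using assms(2) fin by (simp add: subset_prob_True Un_absorb1)
qed

lemma subset_prob_indep:
  assumes "finite E" "E1 \<subseteq> E" "E2 \<subseteq> E" "E1 \<inter> E2 = {}"
  shows "subset_prob (\<lambda>S. Q1 (S \<inter> E1) \<and> Q2 (S \<inter> E2)) E q =
    subset_prob Q1 E1 q * subset_prob Q2 E2 q"
proof -
  have "S \<inter> (E1 \<union> E2) \<inter> E1 = S \<inter> E1" "S \<inter> (E1 \<union> E2) \<inter> E2 = S \<inter> E2" for S by auto
  then have "subset_prob (\<lambda>S. Q1 (S \<inter> E1) \<and> Q2 (S \<inter> E2)) E q =
      subset_prob (\<lambda>S. Q1 (S \<inter> E1) \<and> Q2 (S \<inter> E2)) (E1 \<union> E2) q"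
    using subset_prob_Int[of E "E1 \<union> E2" "\<lambda>S. Q1 (S \<inter> E1) \<and> Q2 (S \<inter> E2)" q] assms by simp
  also have "\<dots> = subset_prob Q1 E1 q * subset_prob Q2 E2 q"
  proof (rule subset_prob_Un)
    fix S1 S2 assume "S1 \<subseteq> E1" "S2 \<subseteq> E2"
    then have "(S1 \<union> S2) \<inter> E1 = S1" "(S1 \<union> S2) \<inter> E2 = S2" using assms(4) by auto
    then show "Q1 ((S1 \<union> S2) \<inter> E1) \<and> Q2 ((S1 \<union> S2) \<inter> E2) \<longleftrightarrow> Q1 S1 \<and> Q2 S2" by simp
  qed (use assms finite_subset in auto)
  finally show ?thesis .
qed

lemma subset_prob_image:
  assumes "inj_on g E" "\<And>S. S \<subseteq> E \<Longrightarrow> Q' (g ` S) \<longleftrightarrow> Q S"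
  shows "subset_prob Q' (g ` E) q = subset_prob Q E q"
  unfolding subset_prob_def
proof (rule sum.reindex_cong[of "(`) g"])
  show "inj_on ((`) g) {S. S \<subseteq> E \<and> Q S}"
    using assms(1) by (intro inj_onI) (auto simp: inj_on_image_eq_iff)
  show "{S. S \<subseteq> g ` E \<and> Q' S} = (`) g ` {S. S \<subseteq> E \<and> Q S}"
    using assms(2) by (auto simp: subset_image_iff)
  fix S assume "S \<in> {S. S \<subseteq> E \<and> Q S}"
  then have S: "inj_on g S" "inj_on g (E - S)" "g ` E - g ` S = g ` (E - S)"
    using assms(1) by (auto intro: inj_on_subset simp: inj_on_image_set_diff[of g E])
  show "(1 - q) ^ card (g ` S) * q ^ card (g ` E - g ` S) = (1 - q) ^ card S * q ^ card (E - S)"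
    using S by (simp add: card_image)
qed

lemma subset_prob_of_real:
  "subset_prob Q E (of_real x :: 'b::{real_algebra_1, comm_ring_1}) = of_real (subset_prob Q E x)"
  by (simp add: subset_prob_def)

subsection \<open>Reliability\<close>

abbreviation reliability :: "'a set \<Rightarrow> 'a set set \<Rightarrow> 'b::comm_ring_1 \<Rightarrow> 'b" where
  "reliability V E \<equiv> subset_prob (connected_graph V) E"

abbreviation split_prob :: "'a set \<Rightarrow> 'a \<Rightarrow> 'a \<Rightarrow> 'a set set \<Rightarrow> 'b::comm_ring_1 \<Rightarrow> 'b" where
  "split_prob V s t E \<equiv> subset_prob (splits V s t) E"

lemma poly_rel_poly: "finite E \<Longrightarrow> poly (rel_poly V E) q = reliability V E q"
  by (auto simp: rel_poly_def subset_prob_def poly_sum card_Diff_subset finite_subset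
      intro!: sum.cong)

lemma simple_graph_induced: "simple_graph V E \<Longrightarrow> A \<subseteq> V \<Longrightarrow> simple_graph A (E \<inter> Pow A)"
  by (auto simp: simple_graph_def intro: finite_subset)

lemma simple_graph_subset: "simple_graph V E \<Longrightarrow> S \<subseteq> E \<Longrightarrow> simple_graph V S"
  by (auto simp: simple_graph_def)

lemma simple_graph_Pow: "simple_graph V E \<Longrightarrow> E \<subseteq> Pow V"
  by (auto simp: simple_graph_def)

lemma simple_graph_finite:
  assumes "simple_graph V E"
  shows "finite V" "finite E"
  using assms by (auto simp: simple_graph_def intro: finite_subset[of E "Pow V"])

lemma simple_graph_edgeE:
  assumes "simple_graph V E" "e \<in> E"
  obtains x y where "e = {x, y}" "x \<noteq> y" "x \<in> V" "y \<in> V"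
  using assms by (auto simp: simple_graph_def card_2_iff)

definition edges_between :: "'a set set \<Rightarrow> 'a set \<Rightarrow> 'a set \<Rightarrow> 'a set set" where
  "edges_between E A B = {e \<in> E. \<exists>a\<in>A. \<exists>b\<in>B. e = {a, b}}"

lemma edges_between_subset: "edges_between E A B \<subseteq> E"
  by (auto simp: edges_between_def)

lemma edges_between_Int: "S \<subseteq> E \<Longrightarrow> S \<inter> edges_between E A B = edges_between S A B"
  by (auto simp: edges_between_def)

lemma edges_between_Un: "edges_between E A (B \<union> C) = edges_between E A B \<union> edges_between E A C"
  by (auto simp: edges_between_def)

lemma edges_between_disjoint:
  assumes "A \<inter> B = {}" "A \<inter> C = {}" "B \<inter> C = {}"
  shows "edges_between E A B \<inter> edges_between E A C = {}"
  using assms by (auto simp: edges_between_def doubleton_eq_iff)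

lemma edges_between_Int_Pow_disjoint:
  "A \<inter> C = {} \<or> B \<inter> C = {} \<Longrightarrow> edges_between E A B \<inter> Pow C = {}"
  by (auto simp: edges_between_def)

lemma simple_graph_Int_Pow_disjoint:
  assumes "simple_graph V E" "A \<inter> B = {}"
  shows "E \<inter> Pow A \<inter> Pow B = {}"
proof -
  have "{} \<notin> E" using assms(1) by (auto simp: simple_graph_def)
  moreover have "e = {}" if "e \<subseteq> A" "e \<subseteq> B" for e using that assms(2) by blast
  ultimately show ?thesis by auto
qed

lemma simple_graph_cut_partition:
  assumes "simple_graph V E"
  shows "E = E \<inter> Pow A \<union> edges_between E A (V - A) \<union> E \<inter> Pow (V - A)"
proof (intro equalityI subsetI)
  fix e assume e: "e \<in> E"
  then obtain x y where "e = {x, y}" "x \<in> V" "y \<in> V" by (rule simple_graph_edgeE[OF assms])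
  with e show "e \<in> E \<inter> Pow A \<union> edges_between E A (V - A) \<union> E \<inter> Pow (V - A)"
    by (cases "x \<in> A"; cases "y \<in> A") (auto simp: edges_between_def insert_commute)
qed (auto simp: edges_between_def)

lemma card_cut_partition:
  assumes G: "simple_graph V E"
  shows "card E = card (E \<inter> Pow A) + card (edges_between E A (V - A)) + card (E \<inter> Pow (V - A))"
proof -
  let ?EA = "E \<inter> Pow A" and ?B = "edges_between E A (V - A)" and ?EB = "E \<inter> Pow (V - A)"
  have "?B \<inter> Pow A = {}" "?B \<inter> Pow (V - A) = {}"
    by (intro edges_between_Int_Pow_disjoint; auto)+
  moreover have "?EA \<inter> Pow (V - A) = {}" by (intro simple_graph_Int_Pow_disjoint[OF G]) auto
  ultimately have disj: "?EA \<inter> ?B = {}" "(?EA \<union> ?B) \<inter> ?EB = {}" by blast+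
  have fin: "finite ?EA" "finite ?B" "finite ?EB"
    using simple_graph_finite(2)[OF G] by (auto intro: finite_subset[OF edges_between_subset])
  have "card E = card (?EA \<union> ?B \<union> ?EB)" using simple_graph_cut_partition[OF G] by (rule arg_cong)
  then show ?thesis using fin disj by (simp add: card_Un_disjoint)
qed

lemma card_edges_between_delete_vertex:
  assumes "finite E" "t \<in> V" "A \<subseteq> V - {t}"
  shows "card (edges_between E A (V - A)) =
    card (edges_between E A (V - {t} - A)) + card (edges_between E A {t})"
proof -
  have fin: "finite (edges_between E A B)" for B
    using edges_between_subset assms(1) by (rule finite_subset)
  have "V - A = (V - {t} - A) \<union> {t}" using assms by auto
  then have "edges_between E A (V - A) = edges_between E A ((V - {t} - A) \<union> {t})" by (rule arg_cong)
  moreover have "edges_between E A (V - {t} - A) \<inter> edges_between E A {t} = {}"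
    using assms(3) by (intro edges_between_disjoint) auto
  ultimately show ?thesis using fin by (simp only: edges_between_Un card_Un_disjoint)
qed

lemma uncut_iff_edges_between:
  assumes "simple_graph V S"
  shows "uncut S A \<longleftrightarrow> edges_between S A (V - A) = {}"
proof
  assume none: "edges_between S A (V - A) = {}"
  have "y \<in> A" if "{x, y} \<in> S" "x \<in> A" for x y
  proof -
    have "y \<in> V" using that(1) simple_graph_Pow[OF assms] by blast
    then show ?thesis using none that by (auto simp: edges_between_def)
  qed
  then show "uncut S A" unfolding uncut_def by (metis insert_commute)
qed (auto simp: edges_between_def dest: uncutD)

lemma component_prob:
  assumes G: "simple_graph V E" and A: "r \<in> A" "A \<subseteq> V"
  shows "subset_prob (\<lambda>S. component S r = A) E q =
    reliability A (E \<inter> Pow A) q * q ^ card (edges_between E A (V - A))"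
proof -
  let ?B = "edges_between E A (V - A)"
  have "subset_prob (\<lambda>S. component S r = A) E q =
      subset_prob (\<lambda>S. connected_graph A (S \<inter> (E \<inter> Pow A)) \<and> S \<inter> ?B = {}) E q"
  proof (rule subset_prob_cong[OF refl])
    fix S assume S: "S \<subseteq> E"
    then have "S \<inter> (E \<inter> Pow A) = S \<inter> Pow A" by auto
    then show "component S r = A \<longleftrightarrow> connected_graph A (S \<inter> (E \<inter> Pow A)) \<and> S \<inter> ?B = {}"
      unfolding component_eq_iff[OF A(1)] uncut_iff_edges_between[OF simple_graph_subset[OF G S]]
        edges_between_Int[OF S] by auto
  qed
  also have "\<dots> = reliability A (E \<inter> Pow A) q * subset_prob (\<lambda>S. S = {}) ?B q"
    using edges_between_Int_Pow_disjoint[of A A "V - A" E] simple_graph_finite[OF G]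
    by (intro subset_prob_indep edges_between_subset) auto
  finally show ?thesis by (simp add: subset_prob_eq_empty)
qed

lemma component_prob_sum:
  assumes G: "simple_graph V E" and r: "r \<in> V"
  shows "(\<Sum>A | r \<in> A \<and> A \<subseteq> V.
    reliability A (E \<inter> Pow A) q * q ^ card (edges_between E A (V - A))) = 1"
proof -
  have fin: "finite V" "finite E" using simple_graph_finite[OF G] .
  have "subset_prob (\<lambda>_. True) E q =
      (\<Sum>A | r \<in> A \<and> A \<subseteq> V. subset_prob (\<lambda>S. True \<and> component S r = A) E q)"
  proof (rule subset_prob_partition)
    fix S assume "S \<subseteq> E"
    then have "component S r \<subseteq> V" using simple_graph_Pow[OF G] r by (intro component_subset) auto
    then show "component S r \<in> {A. r \<in> A \<and> A \<subseteq> V}" by (simp add: component_def linked_refl)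
  qed (use fin in auto)
  then show ?thesis using fin by (simp add: subset_prob_True component_prob[OF G])
qed

lemma component_delete_vertex_iff:
  assumes G: "simple_graph V S" and A: "s \<in> A" "A \<subseteq> V - {t}"
  shows "component (S \<inter> Pow (V - {t})) s = A \<longleftrightarrow>
    connected_graph A (S \<inter> Pow A) \<and> edges_between S A (V - {t} - A) = {}"
proof -
  let ?W = "V - {t}"
  have "simple_graph ?W (S \<inter> Pow ?W)" using G by (rule simple_graph_induced) auto
  moreover have "S \<inter> Pow ?W \<inter> Pow A = S \<inter> Pow A" using A(2) by auto
  moreover have "edges_between (S \<inter> Pow ?W) A (?W - A) = edges_between S A (?W - A)"
    using A(2) by (auto simp: edges_between_def)
  ultimately show ?thesis using component_eq_iff[OF A(1)] uncut_iff_edges_between by metis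
qed

lemma connected_graph_delete_component:
  assumes G: "simple_graph V S" and t: "t \<in> V" and A: "s \<in> A" "A \<subseteq> V - {t}"
    and comp: "component (S \<inter> Pow (V - {t})) s = A"
  shows "connected_graph V (insert {s, t} S) \<longleftrightarrow> connected_graph (V - A) (S \<inter> Pow (V - A))"
    and "connected_graph V S \<longleftrightarrow>
      connected_graph (V - A) (S \<inter> Pow (V - A)) \<and> edges_between S A {t} \<noteq> {}"
proof -
  let ?N = "edges_between S A {t}" and ?SA = "S \<inter> Pow A" and ?SB = "S \<inter> Pow (V - A)"
  have A_conn: "connected_graph A ?SA" and no_exit: "edges_between S A (V - {t} - A) = {}"
    using comp component_delete_vertex_iff[OF G A] by auto
  have "V - A = {t} \<union> (V - {t} - A)" using t A(2) by auto
  then have "edges_between S A (V - A) = edges_between S A ({t} \<union> (V - {t} - A))" by (rule arg_cong)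
  then have exits: "edges_between S A (V - A) = ?N" unfolding edges_between_Un no_exit by simp
  have S: "S = (?SA \<union> ?N) \<union> ?SB" by (rule simple_graph_cut_partition[OF G, of A, unfolded exits])
  have V: "V = insert t A \<union> (V - A)" "insert t A \<inter> (V - A) = {t}" using t A(2) by auto
  have N: "?N \<subseteq> Pow (insert t A)" by (auto simp: edges_between_def)
  have glue: "connected_graph V (T \<union> ?SB) \<longleftrightarrow>
      connected_graph (insert t A) T \<and> connected_graph (V - A) ?SB"
    if "T \<subseteq> Pow (insert t A)" for T
    using connected_graph_one_vertex_union[OF V(2) that, of ?SB] V(1) by auto
  have star: "connected_graph (insert t A) (?SA \<union> N) \<longleftrightarrow> N \<noteq> {}" if "N \<subseteq> (\<lambda>a. {a, t}) ` A" for N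
    using A_conn A(2) that by (intro connected_graph_add_vertex) auto
  have "?N \<subseteq> (\<lambda>a. {a, t}) ` A" by (auto simp: edges_between_def)
  then have stars: "connected_graph (insert t A) (?SA \<union> ?N) \<longleftrightarrow> ?N \<noteq> {}"
      "connected_graph (insert t A) (?SA \<union> insert {s, t} ?N)"
    using star[of ?N] star[of "insert {s, t} ?N"] A(1) by auto
  have "insert {s, t} S = (?SA \<union> insert {s, t} ?N) \<union> ?SB" by (subst S) blast
  moreover have "?SA \<union> insert {s, t} ?N \<subseteq> Pow (insert t A)" using A(1) N by auto
  ultimately show "connected_graph V (insert {s, t} S) \<longleftrightarrow> connected_graph (V - A) ?SB"
    using stars(2) by (simp only: glue simp_thms)
  have "connected_graph V S \<longleftrightarrow>
      connected_graph (insert t A) (?SA \<union> ?N) \<and> connected_graph (V - A) ?SB"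
    using glue[of "?SA \<union> ?N"] N by (subst S) blast
  with stars(1) show "connected_graph V S \<longleftrightarrow> connected_graph (V - A) ?SB \<and> ?N \<noteq> {}" by blast
qed

lemma connected_graph_delete_vertexE:
  assumes G: "simple_graph V S" "connected_graph V S" and st: "s \<in> V" "t \<in> V" "s \<noteq> t"
  obtains A where "s \<in> A" "A \<subseteq> V - {t}" "connected_graph A (S \<inter> Pow A)"
    "connected_graph (V - A) (S \<inter> Pow (V - A))" "edges_between S A {t} \<noteq> {}"
proof -
  define A where "A = component (S \<inter> Pow (V - {t})) s"
  have A: "s \<in> A" "A \<subseteq> V - {t}"
    unfolding A_def using st by (simp add: component_def linked_refl, intro component_subset) auto
  show ?thesis
    using that[OF A] component_delete_vertex_iff[OF G(1) A] A_def G(2)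
      connected_graph_delete_component(2)[OF G(1) st(2) A] by blast
qed

lemma delete_vertex_edges_disjoint:
  assumes G: "simple_graph V E" and A: "A \<subseteq> V - {t}"
  shows "E \<inter> Pow A \<inter> edges_between E A (V - {t} - A) = {}"
    and "edges_between E A {t} \<inter> (E \<inter> Pow (V - A)) = {}"
    and "(E \<inter> Pow A \<union> edges_between E A (V - {t} - A)) \<inter>
      (edges_between E A {t} \<union> E \<inter> Pow (V - A)) = {}"
proof -
  let ?X = "edges_between E A (V - {t} - A)" and ?N = "edges_between E A {t}"
  have "?X \<inter> ?N = {}" using A by (intro edges_between_disjoint) auto
  moreover have "?X \<inter> Pow A = {}" "?N \<inter> Pow A = {}" "?X \<inter> Pow (V - A) = {}" "?N \<inter> Pow (V - A) = {}"
    using A by (intro edges_between_Int_Pow_disjoint; auto)+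
  moreover have "E \<inter> Pow A \<inter> Pow (V - A) = {}" by (intro simple_graph_Int_Pow_disjoint[OF G]) auto
  ultimately show "E \<inter> Pow A \<inter> ?X = {}" "?N \<inter> (E \<inter> Pow (V - A)) = {}"
    "(E \<inter> Pow A \<union> ?X) \<inter> (?N \<union> E \<inter> Pow (V - A)) = {}"
    by blast+
qed

lemma component_delete_vertex_prob:
  assumes G: "simple_graph V E" and t: "t \<in> V" and A: "s \<in> A" "A \<subseteq> V - {t}"
  shows "subset_prob (\<lambda>S. component (S \<inter> Pow (V - {t})) s = A \<and>
      P (edges_between S A {t}) \<and> connected_graph (V - A) (S \<inter> Pow (V - A))) E q =
    reliability A (E \<inter> Pow A) q * q ^ card (edges_between E A (V - {t} - A)) *
      (subset_prob P (edges_between E A {t}) q * reliability (V - A) (E \<inter> Pow (V - A)) q)"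
proof -
  let ?X = "edges_between E A (V - {t} - A)" and ?N = "edges_between E A {t}"
  let ?EA = "E \<inter> Pow A" and ?EB = "E \<inter> Pow (V - A)"
  let ?inside = "\<lambda>S. connected_graph A (S \<inter> ?EA) \<and> S \<inter> ?X = {}"
  let ?outside = "\<lambda>S. P (S \<inter> ?N) \<and> connected_graph (V - A) (S \<inter> ?EB)"
  have fin: "finite E" "finite ?EA" "finite ?EB" "finite ?X" "finite ?N"
    using simple_graph_finite[OF G] by (auto intro: finite_subset[OF edges_between_subset])
  note disj = delete_vertex_edges_disjoint[OF G A(2)]
  have "subset_prob (\<lambda>S. component (S \<inter> Pow (V - {t})) s = A \<and>
      P (edges_between S A {t}) \<and> connected_graph (V - A) (S \<inter> Pow (V - A))) E q =
    subset_prob (\<lambda>S. ?inside (S \<inter> (?EA \<union> ?X)) \<and> ?outside (S \<inter> (?N \<union> ?EB))) E q"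
  proof (rule subset_prob_cong[OF refl])
    fix S assume S: "S \<subseteq> E"
    have Int: "S \<inter> (?EA \<union> ?X) \<inter> ?EA = S \<inter> Pow A"
        "S \<inter> (?EA \<union> ?X) \<inter> ?X = edges_between S A (V - {t} - A)"
        "S \<inter> (?N \<union> ?EB) \<inter> ?N = edges_between S A {t}"
        "S \<inter> (?N \<union> ?EB) \<inter> ?EB = S \<inter> Pow (V - A)"
      using S edges_between_Int[OF S] by auto
    show "component (S \<inter> Pow (V - {t})) s = A \<and>
        P (edges_between S A {t}) \<and> connected_graph (V - A) (S \<inter> Pow (V - A)) \<longleftrightarrow>
      ?inside (S \<inter> (?EA \<union> ?X)) \<and> ?outside (S \<inter> (?N \<union> ?EB))"
      unfolding Int component_delete_vertex_iff[OF simple_graph_subset[OF G S] A] by blast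
  qed
  also have "\<dots> = subset_prob ?inside (?EA \<union> ?X) q * subset_prob ?outside (?N \<union> ?EB) q"
    using fin disj edges_between_subset[of E A] by (intro subset_prob_indep) auto
  also have "subset_prob ?inside (?EA \<union> ?X) q = reliability A ?EA q * subset_prob (\<lambda>S. S = {}) ?X q"
    using fin disj by (intro subset_prob_indep) auto
  also have "subset_prob ?outside (?N \<union> ?EB) q = subset_prob P ?N q * reliability (V - A) ?EB q"
    using fin disj by (intro subset_prob_indep) auto
  finally show ?thesis by (simp add: subset_prob_eq_empty)
qed

lemma subset_prob_delete_vertex:
  assumes G: "simple_graph V E" and st: "s \<in> V" "t \<in> V" "s \<noteq> t"
    and Q: "\<And>S A. S \<subseteq> E \<Longrightarrow> s \<in> A \<Longrightarrow> A \<subseteq> V - {t} \<Longrightarrow> component (S \<inter> Pow (V - {t})) s = A \<Longrightarrow>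
      Q S \<longleftrightarrow> P (edges_between S A {t}) \<and> connected_graph (V - A) (S \<inter> Pow (V - A))"
  shows "subset_prob Q E q = (\<Sum>A | s \<in> A \<and> A \<subseteq> V - {t}.
    reliability A (E \<inter> Pow A) q * q ^ card (edges_between E A (V - {t} - A)) *
      (subset_prob P (edges_between E A {t}) q * reliability (V - A) (E \<inter> Pow (V - A)) q))"
proof -
  let ?comp = "\<lambda>S. component (S \<inter> Pow (V - {t})) s"
  have fin: "finite V" "finite E" using simple_graph_finite[OF G] .
  have "subset_prob Q E q =
      (\<Sum>A | s \<in> A \<and> A \<subseteq> V - {t}. subset_prob (\<lambda>S. Q S \<and> ?comp S = A) E q)"
  proof (rule subset_prob_partition)
    fix S
    have "?comp S \<subseteq> V - {t}" using st by (intro component_subset) auto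
    then show "?comp S \<in> {A. s \<in> A \<and> A \<subseteq> V - {t}}" by (simp add: component_def linked_refl)
  qed (use fin in auto)
  also have "\<dots> = (\<Sum>A | s \<in> A \<and> A \<subseteq> V - {t}. subset_prob (\<lambda>S. ?comp S = A \<and>
      P (edges_between S A {t}) \<and> connected_graph (V - A) (S \<inter> Pow (V - A))) E q)"
    using Q by (intro sum.cong subset_prob_cong refl) blast
  finally show ?thesis by (simp add: component_delete_vertex_prob[OF G st(2)])
qed

lemma reliability_delete_vertex:
  assumes G: "simple_graph V E" and st: "s \<in> V" "t \<in> V" "s \<noteq> t"
  shows "reliability V E q = (\<Sum>A | s \<in> A \<and> A \<subseteq> V - {t}.
    reliability A (E \<inter> Pow A) q * q ^ card (edges_between E A (V - {t} - A)) *
      ((1 - q ^ card (edges_between E A {t})) * reliability (V - A) (E \<inter> Pow (V - A)) q))"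
proof -
  have fin: "finite (edges_between E A {t})" for A
    using simple_graph_finite(2)[OF G] edges_between_subset by (rule finite_subset[rotated])
  have some_edge: "1 - q ^ card (edges_between E A {t}) =
      subset_prob (\<lambda>S. S \<noteq> {}) (edges_between E A {t}) q" for A
    by (simp add: subset_prob_not[OF fin] subset_prob_eq_empty)
  show ?thesis
    unfolding some_edge
    using connected_graph_delete_component(2)[OF simple_graph_subset[OF G] st(2)]
    by (intro subset_prob_delete_vertex G st) blast
qed

lemma split_prob_component_sum:
  assumes G: "simple_graph V E" and st: "s \<in> V" "t \<in> V" "s \<noteq> t"
  shows "split_prob V s t E q = (\<Sum>A | s \<in> A \<and> A \<subseteq> V - {t}.
    reliability A (E \<inter> Pow A) q * q ^ card (edges_between E A (V - A)) *
      reliability (V - A) (E \<inter> Pow (V - A)) q)"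
proof -
  let ?rel = "\<lambda>A. reliability A (E \<inter> Pow A) q" and ?N = "\<lambda>A. edges_between E A {t}"
  have "split_prob V s t E q = (\<Sum>A | s \<in> A \<and> A \<subseteq> V - {t}.
      ?rel A * q ^ card (edges_between E A (V - {t} - A)) *
        (subset_prob (\<lambda>S. S = {}) (?N A) q * ?rel (V - A)))"
    using connected_graph_delete_component[OF simple_graph_subset[OF G] st(2)]
    by (intro subset_prob_delete_vertex G st) blast
  also have "\<dots> = (\<Sum>A | s \<in> A \<and> A \<subseteq> V - {t}.
      ?rel A * q ^ card (edges_between E A (V - A)) * ?rel (V - A))"
  proof (rule sum.cong[OF refl])
    fix A assume "A \<in> {A. s \<in> A \<and> A \<subseteq> V - {t}}"
    then have "card (edges_between E A (V - A)) =
        card (edges_between E A (V - {t} - A)) + card (?N A)"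
      using simple_graph_finite(2)[OF G] st by (intro card_edges_between_delete_vertex) auto
    then show "?rel A * q ^ card (edges_between E A (V - {t} - A)) *
        (subset_prob (\<lambda>S. S = {}) (?N A) q * ?rel (V - A)) =
      ?rel A * q ^ card (edges_between E A (V - A)) * ?rel (V - A)"
      by (simp add: subset_prob_eq_empty power_add mult_ac)
  qed
  finally show ?thesis .
qed

subsection \<open>Real roots\<close>

definition signed_reliability :: "'a set \<Rightarrow> 'a set set \<Rightarrow> real \<Rightarrow> real" where
  "signed_reliability V E x = (- 1) ^ (card V + 1) * x ^ card E * reliability V E x"

lemma signed_reliability_empty: "signed_reliability {} E x = 0"
  by (simp add: signed_reliability_def subset_prob_def connected_graph_def)

lemma signed_reliability_singleton:
  assumes "simple_graph {v} E"
  shows "signed_reliability {v} E x = 1"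
proof -
  have "E = {}" using assms by (auto simp: simple_graph_def subset_singleton_iff)
  moreover have "{S. S \<subseteq> {} \<and> connected_graph {v} S} = {{}}" by (auto simp: connected_graph_def)
  ultimately show ?thesis by (simp add: signed_reliability_def subset_prob_def)
qed

definition signed_cut_weight :: "'a set \<Rightarrow> 'a set set \<Rightarrow> 'a \<Rightarrow> 'a set \<Rightarrow> real \<Rightarrow> real" where
  "signed_cut_weight V E t A x = (x ^ card (edges_between E A (V - {t} - A)))\<^sup>2 *
    (x ^ card (edges_between E A {t}) * (x ^ card (edges_between E A {t}) - 1))"

lemma signed_cut_weight_nonneg:
  assumes "1 < \<bar>x\<bar>"
  shows "0 \<le> signed_cut_weight V E t A x"
proof -
  define y where "y = x ^ card (edges_between E A {t})"
  have "1 \<le> \<bar>y\<bar>" using assms by (simp add: y_def power_abs one_le_power)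
  then have "0 \<le> y * (y - 1)" by (auto simp: abs_if zero_le_mult_iff split: if_splits)
  then show ?thesis
    unfolding signed_cut_weight_def y_def by (rule mult_nonneg_nonneg[OF zero_le_power2])
qed

lemma signed_cut_weight_pos:
  assumes "1 < \<bar>x\<bar>" "finite E" "edges_between E A {t} \<noteq> {}"
  shows "0 < signed_cut_weight V E t A x"
proof -
  define y where "y = x ^ card (edges_between E A {t})"
  have "0 < card (edges_between E A {t})"
    using assms(2,3) finite_subset[OF edges_between_subset] by (auto simp: card_gt_0_iff)
  then have "1 < \<bar>y\<bar>" using assms(1) by (simp add: y_def power_abs one_less_power)
  then have "0 < y * (y - 1)" by (auto simp: abs_if zero_less_mult_iff split: if_splits)
  moreover have "0 < (x ^ n)\<^sup>2" for n using assms(1) by auto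
  ultimately show ?thesis unfolding signed_cut_weight_def y_def by (metis mult_pos_pos)
qed

lemma signed_reliability_delete_vertex:
  assumes G: "simple_graph V E" and st: "s \<in> V" "t \<in> V" "s \<noteq> t"
  shows "signed_reliability V E x = (\<Sum>A | s \<in> A \<and> A \<subseteq> V - {t}.
    signed_reliability A (E \<inter> Pow A) x * signed_reliability (V - A) (E \<inter> Pow (V - A)) x *
      signed_cut_weight V E t A x)"
  unfolding signed_reliability_def reliability_delete_vertex[OF assms] sum_distrib_left
proof (rule sum.cong[OF refl])
  fix A assume "A \<in> {A. s \<in> A \<and> A \<subseteq> V - {t}}"
  then have A: "A \<subseteq> V" "A \<subseteq> V - {t}" by auto
  have fin: "finite V" "finite E" using simple_graph_finite[OF G] .
  have cardV: "card V = card A + card (V - A)"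
    using A(1) fin(1) by (simp add: card_Diff_subset card_mono finite_subset)
  note cardE = card_cut_partition[OF G, of A,
      unfolded card_edges_between_delete_vertex[OF fin(2) st(2) A(2)]]
  show "(- 1) ^ (card V + 1) * x ^ card E * (reliability A (E \<inter> Pow A) x *
      x ^ card (edges_between E A (V - {t} - A)) *
      ((1 - x ^ card (edges_between E A {t})) * reliability (V - A) (E \<inter> Pow (V - A)) x)) =
    (- 1) ^ (card A + 1) * x ^ card (E \<inter> Pow A) * reliability A (E \<inter> Pow A) x *
      ((- 1) ^ (card (V - A) + 1) * x ^ card (E \<inter> Pow (V - A)) *
        reliability (V - A) (E \<inter> Pow (V - A)) x) * signed_cut_weight V E t A x"
    unfolding cardV cardE signed_cut_weight_def
    by (simp add: power_add power2_eq_square algebra_simps)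
qed

lemma signed_reliability_nonneg_pos:
  assumes x: "1 < \<bar>x\<bar>"
  shows "simple_graph V E \<Longrightarrow>
    0 \<le> signed_reliability V E x \<and> (connected_graph V E \<longrightarrow> 0 < signed_reliability V E x)"
proof (induction "card V" arbitrary: V E rule: less_induct)
  case less
  note G = less.prems
  have fin: "finite V" "finite E" using simple_graph_finite[OF G] .
  consider (empty) "V = {}" | (singleton) t where "V = {t}"
    | (delete) s t where "s \<in> V" "t \<in> V" "s \<noteq> t" by blast
  then show ?case
  proof cases
    case empty
    then show ?thesis by (simp add: signed_reliability_empty connected_graph_def)
  next
    case (singleton t)
    then show ?thesis using G by (simp add: signed_reliability_singleton)
  next
    case (delete s t)
    let ?I = "{A. s \<in> A \<and> A \<subseteq> V - {t}}"
    define h where "h B = signed_reliability B (E \<inter> Pow B) x" for B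
    define f where "f A = h A * h (V - A) * signed_cut_weight V E t A x" for A
    have sum: "signed_reliability V E x = sum f ?I"
      unfolding f_def h_def by (rule signed_reliability_delete_vertex[OF G delete])
    have IH: "0 \<le> h B" "connected_graph B (E \<inter> Pow B) \<Longrightarrow> 0 < h B" if "B \<subset> V" for B
      using less.hyps[of B "E \<inter> Pow B"] psubset_card_mono[OF fin(1) that] that
        simple_graph_induced[OF G, of B] by (auto simp: h_def)
    have psub: "A \<subset> V" "V - A \<subset> V" if "A \<in> ?I" for A using that delete by auto
    have nonneg: "0 \<le> f A" if "A \<in> ?I" for A
      unfolding f_def by (intro mult_nonneg_nonneg IH(1) psub[OF that] signed_cut_weight_nonneg x)
    have "0 < sum f ?I" if "connected_graph V E"
    proof -
      obtain A where A: "A \<in> ?I" and conn: "connected_graph A (E \<inter> Pow A)"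
          "connected_graph (V - A) (E \<inter> Pow (V - A))" and N: "edges_between E A {t} \<noteq> {}"
        by (rule connected_graph_delete_vertexE[OF G \<open>connected_graph V E\<close> delete]) blast
      have "0 < f A"
        unfolding f_def by (intro mult_pos_pos IH(2) psub[OF A] conn signed_cut_weight_pos x fin N)
      then show ?thesis using A nonneg fin by (intro sum_pos2[of ?I A]) auto
    qed
    then show ?thesis unfolding sum using nonneg by (auto intro: sum_nonneg)
  qed
qed

lemma reliability_pos:
  fixes x :: real
  assumes "finite E" "connected_graph V E" "0 < x" "x < 1"
  shows "0 < reliability V E x"
  unfolding subset_prob_def using assms by (intro sum_pos2[of _ E]) auto

lemma real_reliability_root_range:
  fixes x :: real
  assumes G: "simple_graph V E" "connected_graph V E" and root: "reliability V E x = 0"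
  shows "x \<in> {-1..0} \<union> {1}"
proof (rule ccontr)
  assume "x \<notin> {-1..0} \<union> {1}"
  then consider (probability) "0 < x" "x < 1" | (large) "1 < \<bar>x\<bar>" by fastforce
  then show False
  proof cases
    case probability
    then have "0 < reliability V E x"
      by (rule reliability_pos[OF simple_graph_finite(2)[OF G(1)] G(2)])
    then show False using root by simp
  next
    case large
    then have "0 < signed_reliability V E x"
      using signed_reliability_nonneg_pos[OF _ G(1)] G(2) by blast
    then show False using root by (simp add: signed_reliability_def)
  qed
qed

subsection \<open>Two-terminal graphs\<close>

lemma connected_insert_prob:
  assumes "finite E"
  shows "subset_prob (\<lambda>S. connected_graph V (insert {s, t} S)) E q =
    reliability V E q + split_prob V s t E q"
proof -
  have "connected_graph V (insert {s, t} S) \<longleftrightarrow> connected_graph V S \<or> splits V s t S" for S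
    using connected_graph_mono[of V S "insert {s, t} S"] by blast
  then show ?thesis
    using subset_prob_disj[OF assms, of "connected_graph V" "splits V s t" q] by simp
qed

lemma parallel_probs:
  assumes V: "V1 \<inter> V2 = {s, t}"
    and E: "E1 \<subseteq> Pow V1" "E2 \<subseteq> Pow V2" "E1 \<inter> E2 = {}" "finite E1" "finite E2"
  shows "split_prob (V1 \<union> V2) s t (E1 \<union> E2) q = split_prob V1 s t E1 q * split_prob V2 s t E2 q"
      (is ?split)
    and "reliability (V1 \<union> V2) (E1 \<union> E2) q = reliability V1 E1 q * reliability V2 E2 q +
      reliability V1 E1 q * split_prob V2 s t E2 q + split_prob V1 s t E1 q * reliability V2 E2 q"
proof -
  have S: "S1 \<subseteq> Pow V1" "S2 \<subseteq> Pow V2" if "S1 \<subseteq> E1" "S2 \<subseteq> E2" for S1 S2 using that E by auto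
  show split: ?split using E by (intro subset_prob_Un splits_parallel[OF V S])
  have "subset_prob (\<lambda>S. connected_graph (V1 \<union> V2) (insert {s, t} S)) (E1 \<union> E2) q =
      subset_prob (\<lambda>S. connected_graph V1 (insert {s, t} S)) E1 q *
      subset_prob (\<lambda>S. connected_graph V2 (insert {s, t} S)) E2 q"
    using E by (intro subset_prob_Un connected_parallel[OF V S])
  then show "reliability (V1 \<union> V2) (E1 \<union> E2) q = reliability V1 E1 q * reliability V2 E2 q +
      reliability V1 E1 q * split_prob V2 s t E2 q + split_prob V1 s t E1 q * reliability V2 E2 q"
    using split E by (simp add: connected_insert_prob algebra_simps)
qed

lemma series_probs:
  assumes V: "V1 \<inter> V2 = {u}" "s \<in> V1" "t \<in> V2"
    and E: "E1 \<subseteq> Pow V1" "E2 \<subseteq> Pow V2" "E1 \<inter> E2 = {}" "finite E1" "finite E2"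
  shows "reliability (V1 \<union> V2) (E1 \<union> E2) q = reliability V1 E1 q * reliability V2 E2 q" (is ?rel)
    and "split_prob (V1 \<union> V2) s t (E1 \<union> E2) q =
      reliability V1 E1 q * split_prob V2 u t E2 q + split_prob V1 s u E1 q * reliability V2 E2 q"
proof -
  let ?E = "E1 \<union> E2"
  have S: "S1 \<subseteq> Pow V1" "S2 \<subseteq> Pow V2" if "S1 \<subseteq> E1" "S2 \<subseteq> E2" for S1 S2 using that E by auto
  show ?rel using E by (intro subset_prob_Un connected_graph_one_vertex_union[OF V(1) S])
  have "subset_prob (splits (V1 \<union> V2) s t) ?E q =
      subset_prob (\<lambda>S. (connected_graph V1 (S \<inter> E1) \<and> splits V2 u t (S \<inter> E2))
        \<or> (splits V1 s u (S \<inter> E1) \<and> connected_graph V2 (S \<inter> E2))) ?E q"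
  proof (rule subset_prob_cong[OF refl])
    fix S assume "S \<subseteq> ?E"
    then have "S = S \<inter> E1 \<union> S \<inter> E2" by auto
    then show "splits (V1 \<union> V2) s t S \<longleftrightarrow> (connected_graph V1 (S \<inter> E1) \<and> splits V2 u t (S \<inter> E2))
        \<or> (splits V1 s u (S \<inter> E1) \<and> connected_graph V2 (S \<inter> E2))"
      using splits_series[OF V S[of "S \<inter> E1" "S \<inter> E2"]] by simp
  qed
  also have "\<dots> = subset_prob (\<lambda>S. connected_graph V1 (S \<inter> E1) \<and> splits V2 u t (S \<inter> E2)) ?E q
      + subset_prob (\<lambda>S. splits V1 s u (S \<inter> E1) \<and> connected_graph V2 (S \<inter> E2)) ?E q"
    using E by (intro subset_prob_disj) auto
  also have "\<dots> =
      reliability V1 E1 q * split_prob V2 u t E2 q + split_prob V1 s u E1 q * reliability V2 E2 q"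
    using E by (intro arg_cong2[of _ _ _ _ "(+)"] subset_prob_indep) auto
  finally show "split_prob (V1 \<union> V2) s t ?E q = \<dots>" .
qed

lemma single_edge_probs:
  assumes "s \<noteq> t"
  shows "reliability {s, t} {{s, t}} q = 1 - q" "split_prob {s, t} s t {{s, t}} q = q"
proof -
  have "uncut {} {s}" by (simp add: uncut_def)
  then have not_conn: "\<not> connected_graph {s, t} {}"
    using connected_graph_uncut[of "{s, t}" "{}" "{s}"] assms by auto
  have "reliability {s, t} {{s, t}} q = subset_prob (\<lambda>S. S \<noteq> {}) {{s, t}} q"
    using connected_single_edge[of s t] not_conn
    by (intro subset_prob_cong) (auto simp: subset_singleton_iff)
  then show "reliability {s, t} {{s, t}} q = 1 - q"
    by (simp add: subset_prob_not subset_prob_eq_empty)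
  have "split_prob {s, t} s t {{s, t}} q = subset_prob (\<lambda>S. S = {}) {{s, t}} q"
    using connected_single_edge[of s t] not_conn
    by (intro subset_prob_cong) (auto simp: subset_singleton_iff)
  then show "split_prob {s, t} s t {{s, t}} q = q" by (simp add: subset_prob_eq_empty)
qed

lemma simple_graph_image:
  assumes "simple_graph V E" "inj_on f V"
  shows "simple_graph (f ` V) ((`) f ` E)"
  unfolding simple_graph_def
proof (intro conjI ballI)
  fix e assume "e \<in> (`) f ` E"
  then obtain e' where "e = f ` e'" "e' \<subseteq> V" "card e' = 2"
    using assms(1) by (auto simp: simple_graph_def)
  then show "e \<subseteq> f ` V" "card e = 2"
    using card_image[OF inj_on_subset[OF assms(2), of e']] by auto
qed (use assms(1) in \<open>simp add: simple_graph_def\<close>)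

lemma probs_image:
  assumes f: "inj_on f V" and E: "E \<subseteq> Pow V"
  shows "reliability (f ` V) ((`) f ` E) q = reliability V E q"
    and "s \<in> V \<Longrightarrow> t \<in> V \<Longrightarrow> split_prob (f ` V) (f s) (f t) ((`) f ` E) q = split_prob V s t E q"
proof -
  have inj: "inj_on ((`) f) E" using inj_on_image_Pow[OF f] E by (rule inj_on_subset)
  have iff: "connected_graph (f ` V) ((`) f ` S) \<longleftrightarrow> connected_graph V S" if "S \<subseteq> Pow V" for S
    by (rule connected_graph_image_iff[OF f that])
  show "reliability (f ` V) ((`) f ` E) q = reliability V E q"
    using E by (intro subset_prob_image inj iff) auto
  assume st: "s \<in> V" "t \<in> V"
  show "split_prob (f ` V) (f s) (f t) ((`) f ` E) q = split_prob V s t E q"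
  proof (rule subset_prob_image[OF inj])
    fix S assume "S \<subseteq> E"
    then have S: "S \<subseteq> Pow V" "insert {s, t} S \<subseteq> Pow V" using E st by auto
    have "insert {f s, f t} ((`) f ` S) = (`) f ` insert {s, t} S" by simp
    then show "splits (f ` V) (f s) (f t) ((`) f ` S) \<longleftrightarrow> splits V s t S"
      using iff[OF S(1)] iff[OF S(2)] by simp
  qed
qed

text \<open>Excluding the edge between the terminals keeps parallel compositions simple.\<close>

definition two_terminal_graph :: "'a set \<Rightarrow> 'a set set \<Rightarrow> 'a \<Rightarrow> 'a \<Rightarrow> bool" where
  "two_terminal_graph V E s t \<longleftrightarrow>
    simple_graph V E \<and> connected_graph V E \<and> s \<in> V \<and> t \<in> V \<and> s \<noteq> t \<and> {s, t} \<notin> E"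

lemma two_terminal_graphD:
  assumes "two_terminal_graph V E s t"
  shows "simple_graph V E" "connected_graph V E" "s \<in> V" "t \<in> V" "s \<noteq> t" "{s, t} \<notin> E"
  using assms by (simp_all add: two_terminal_graph_def)

lemma two_terminal_graph_image:
  assumes G: "two_terminal_graph V E s t" and f: "inj_on f V"
  shows "two_terminal_graph (f ` V) ((`) f ` E) (f s) (f t)"
proof -
  note D = two_terminal_graphD[OF G]
  have "{f s, f t} \<notin> (`) f ` E"
  proof
    assume "{f s, f t} \<in> (`) f ` E"
    then obtain e where e: "e \<in> E" "f ` e = f ` {s, t}" by auto
    have "e = {s, t}"
      by (rule inj_on_image_eq_iff[OF f, THEN iffD1, OF _ _ e(2)])
        (use e(1) D(3,4) simple_graph_Pow[OF D(1)] in auto)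
    then show False using e(1) D(6) by simp
  qed
  moreover have "f s \<noteq> f t" using inj_onD[OF f] D(3-5) by blast
  ultimately show ?thesis
    using simple_graph_image[OF D(1) f] connected_graph_image[OF D(2)] D(3,4)
    by (simp add: two_terminal_graph_def)
qed

lemma simple_graphs_edge_disjoint:
  assumes "simple_graph V1 E1" "simple_graph V2 E2" "V1 \<inter> V2 \<subseteq> {s, t}" "{s, t} \<notin> E1"
  shows "E1 \<inter> E2 = {}"
proof (rule equals0I)
  fix e assume e: "e \<in> E1 \<inter> E2"
  then have "e \<in> E1" by simp
  then obtain x y where xy: "e = {x, y}" "x \<noteq> y" by (rule simple_graph_edgeE[OF assms(1)])
  have "e \<subseteq> V1 \<inter> V2" using e assms(1,2) by (auto simp: simple_graph_def)
  then have "e \<subseteq> {s, t}" using assms(3) by (rule order.trans)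
  then have "e = {s, t}" using xy by auto
  then show False using \<open>e \<in> E1\<close> assms(4) by simp
qed

lemma two_terminal_graph_parallel:
  assumes G1: "two_terminal_graph V1 E1 s t" and G2: "two_terminal_graph V2 E2 s t"
    and V: "V1 \<inter> V2 = {s, t}"
  shows "two_terminal_graph (V1 \<union> V2) (E1 \<union> E2) s t"
  unfolding two_terminal_graph_def
proof (intro conjI)
  note D1 = two_terminal_graphD[OF G1] and D2 = two_terminal_graphD[OF G2]
  show "simple_graph (V1 \<union> V2) (E1 \<union> E2)" using D1(1) D2(1) by (auto simp: simple_graph_def)
  show "connected_graph (V1 \<union> V2) (E1 \<union> E2)" using D1(2) D2(2) V by (intro connected_graph_Un) auto
qed (use two_terminal_graphD[OF G1] two_terminal_graphD[OF G2] in simp_all)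

lemma two_terminal_graph_series:
  assumes G1: "simple_graph V1 E1" "connected_graph V1 E1"
    and G2: "simple_graph V2 E2" "connected_graph V2 E2"
    and V: "V1 \<inter> V2 = {u}" "s \<in> V1" "t \<in> V2" "s \<noteq> u" "t \<noteq> u"
  shows "two_terminal_graph (V1 \<union> V2) (E1 \<union> E2) s t"
  unfolding two_terminal_graph_def
proof (intro conjI)
  have "s \<notin> V2" "t \<notin> V1" using V by auto
  then show "{s, t} \<notin> E1 \<union> E2" using G1(1) G2(1) by (auto simp: simple_graph_def)
  show "simple_graph (V1 \<union> V2) (E1 \<union> E2)" using G1(1) G2(1) by (auto simp: simple_graph_def)
  show "connected_graph (V1 \<union> V2) (E1 \<union> E2)"
    using G1(2) G2(2) V(1) by (intro connected_graph_Un) auto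
qed (use V in auto)

definition realizable_probs :: "'b::comm_ring_1 \<Rightarrow> 'b \<Rightarrow> 'b \<Rightarrow> bool" where
  "realizable_probs q c d \<longleftrightarrow> (\<exists>(V :: nat set) E s t.
    two_terminal_graph V E s t \<and> reliability V E q = c \<and> split_prob V s t E q = d)"

lemma realizable_probsI:
  fixes V :: "nat set"
  assumes "two_terminal_graph V E s t"
  shows "realizable_probs q (reliability V E q) (split_prob V s t E q)"
  using assms by (auto simp: realizable_probs_def)

lemma realizable_probs_copyE:
  fixes s t :: nat
  assumes "realizable_probs q c d" "s \<noteq> t" "finite F"
  obtains V E where "two_terminal_graph V E s t" "V \<inter> F \<subseteq> {s, t}"
    "reliability V E q = c" "split_prob V s t E q = d"
proof -
  obtain V E s' t' where G: "two_terminal_graph V E s' (t' :: nat)"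
    and probs: "reliability V E q = c" "split_prob V s' t' E q = d"
    using assms(1) by (auto simp: realizable_probs_def)
  note D = two_terminal_graphD[OF G]
  define M where "M = Suc (Max (insert s (insert t F)))"
  have M: "x < M" if "x \<in> insert s (insert t F)" for x
    unfolding M_def less_Suc_eq_le using that assms(3) by (intro Max_ge) auto
  define f where "f x = (if x = s' then s else if x = t' then t else M + x)" for x
  have f: "f s' = s" "f t' = t" using D(5) by (simp_all add: f_def)
  have inj: "inj_on f V" using assms(2) M[of s] M[of t] by (auto simp: inj_on_def f_def)
  have "two_terminal_graph (f ` V) ((`) f ` E) s t"
    using two_terminal_graph_image[OF G inj] by (simp only: f)
  moreover have "f ` V \<inter> F \<subseteq> {s, t}" using M by (force simp: f_def)
  moreover have "reliability (f ` V) ((`) f ` E) q = c" "split_prob (f ` V) s t ((`) f ` E) q = d"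
    using probs probs_image(1)[OF inj simple_graph_Pow[OF D(1)], of q]
      probs_image(2)[OF inj simple_graph_Pow[OF D(1)] D(3,4), of q] f by simp_all
  ultimately show ?thesis by (rule that)
qed

lemma realizable_probs_parallel:
  assumes "realizable_probs q c1 d1" "realizable_probs q c2 d2"
  shows "realizable_probs q (c1 * c2 + c1 * d2 + d1 * c2) (d1 * d2)"
proof -
  obtain V1 E1 where G1: "two_terminal_graph V1 E1 0 (1 :: nat)"
    and probs1: "reliability V1 E1 q = c1" "split_prob V1 0 1 E1 q = d1"
    by (rule realizable_probs_copyE[OF assms(1) zero_neq_one finite.emptyI])
  note D1 = two_terminal_graphD[OF G1]
  obtain V2 E2 where G2: "two_terminal_graph V2 E2 0 (1 :: nat)" and sub: "V2 \<inter> V1 \<subseteq> {0, 1}"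
    and probs2: "reliability V2 E2 q = c2" "split_prob V2 0 1 E2 q = d2"
    by (rule realizable_probs_copyE[OF assms(2) zero_neq_one simple_graph_finite(1)[OF D1(1)]])
  note D2 = two_terminal_graphD[OF G2]
  have V: "V1 \<inter> V2 = {0, 1}" using sub D1(3,4) D2(3,4) by auto
  have disj: "E1 \<inter> E2 = {}" using simple_graphs_edge_disjoint[OF D1(1) D2(1) _ D1(6)] V by simp
  note probs = parallel_probs[OF V simple_graph_Pow[OF D1(1)] simple_graph_Pow[OF D2(1)] disj
      simple_graph_finite(2)[OF D1(1)] simple_graph_finite(2)[OF D2(1)]]
  show ?thesis
    using realizable_probsI[OF two_terminal_graph_parallel[OF G1 G2 V], of q]
    unfolding probs probs1 probs2 .
qed

lemma realizable_probs_series_graphs: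
  fixes V1 V2 :: "nat set"
  assumes G1: "simple_graph V1 E1" "connected_graph V1 E1"
    and G2: "simple_graph V2 E2" "connected_graph V2 E2"
    and V: "V1 \<inter> V2 = {u}" "s \<in> V1" "t \<in> V2" "s \<noteq> u" "t \<noteq> u"
  shows "realizable_probs q (reliability V1 E1 q * reliability V2 E2 q)
    (reliability V1 E1 q * split_prob V2 u t E2 q + split_prob V1 s u E1 q * reliability V2 E2 q)"
proof -
  have "{u, u} \<notin> E1" using G1(1) by (auto simp: simple_graph_def)
  then have disj: "E1 \<inter> E2 = {}"
    using simple_graphs_edge_disjoint[OF G1(1) G2(1), of u u] V(1) by simp
  note probs = series_probs[OF V(1,2,3) simple_graph_Pow[OF G1(1)] simple_graph_Pow[OF G2(1)] disj
      simple_graph_finite(2)[OF G1(1)] simple_graph_finite(2)[OF G2(1)]]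
  show ?thesis
    using realizable_probsI[OF two_terminal_graph_series[OF assms], of q] unfolding probs .
qed

lemma realizable_probs_series:
  assumes "realizable_probs q c1 d1" "realizable_probs q c2 d2"
  shows "realizable_probs q (c1 * c2) (c1 * d2 + d1 * c2)"
proof -
  have neq: "0 \<noteq> (2 :: nat)" "2 \<noteq> (1 :: nat)" "finite {1 :: nat}" by simp_all
  obtain V1 E1 where G1: "two_terminal_graph V1 E1 0 (2 :: nat)" and sub1: "V1 \<inter> {1} \<subseteq> {0, 2}"
    and probs1: "reliability V1 E1 q = c1" "split_prob V1 0 2 E1 q = d1"
    by (rule realizable_probs_copyE[OF assms(1) neq(1,3)])
  note D1 = two_terminal_graphD[OF G1]
  obtain V2 E2 where G2: "two_terminal_graph V2 E2 2 (1 :: nat)" and sub2: "V2 \<inter> V1 \<subseteq> {2, 1}"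
    and probs2: "reliability V2 E2 q = c2" "split_prob V2 2 1 E2 q = d2"
    by (rule realizable_probs_copyE[OF assms(2) neq(2) simple_graph_finite(1)[OF D1(1)]])
  note D2 = two_terminal_graphD[OF G2]
  have V: "V1 \<inter> V2 = {2}" using sub1 sub2 D1(4) D2(3) by auto
  show ?thesis
    using realizable_probs_series_graphs[OF D1(1,2) D2(1,2) V D1(3) D2(4) D1(5) D2(5)[symmetric],
        of q] unfolding probs1 probs2 .
qed

lemma realizable_probs_pendant_edge:
  fixes V :: "nat set"
  assumes G: "simple_graph V E" "connected_graph V E" and st: "s \<in> V" "t \<in> V" "s \<noteq> t"
  shows "realizable_probs q ((1 - q) * reliability V E q)
    ((1 - q) * split_prob V s t E q + q * reliability V E q)"
proof -
  obtain v where v: "v \<notin> V"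
    using ex_new_if_finite[OF infinite_UNIV_nat simple_graph_finite(1)[OF G(1)]] by blast
  then have vs: "v \<noteq> s" using st by auto
  have "simple_graph {v, s} {{v, s}}" using vs by (auto simp: simple_graph_def)
  moreover have "{v, s} \<inter> V = {s}" using v st by auto
  ultimately show ?thesis
    using realizable_probs_series_graphs[OF _ connected_single_edge G, of v s s v t q] st vs
      single_edge_probs[OF vs, of q] by simp
qed

lemma realizable_probs_parallel_power:
  assumes "realizable_probs q c d" "k > 0"
  shows "realizable_probs q ((c + d) ^ k - d ^ k) (d ^ k)"
  using assms(2)
proof (induction k rule: nat_induct_non_zero)
  case 1
  then show ?case using assms(1) by simp
next
  case (Suc k)
  have "((c + d) ^ k - d ^ k) * c + ((c + d) ^ k - d ^ k) * d + d ^ k * c =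
      (c + d) ^ Suc k - d ^ Suc k"
    "d ^ k * d = d ^ Suc k" by (simp_all add: algebra_simps)
  then show ?case using realizable_probs_parallel[OF Suc.IH assms(1)] by (simp only:)
qed

lemma realizable_probs_series_power:
  assumes "realizable_probs q c d" "n > 0"
  shows "realizable_probs q (c ^ n) (of_nat n * c ^ (n - 1) * d)"
  using assms(2)
proof (induction n rule: nat_induct_non_zero)
  case 1
  then show ?case using assms(1) by simp
next
  case (Suc n)
  have "c ^ n * d + of_nat n * c ^ (n - 1) * d * c = of_nat (Suc n) * c ^ (Suc n - 1) * d"
    using Suc.hyps by (cases n) (simp_all add: algebra_simps)
  moreover have "c ^ n * c = c ^ Suc n" by simp
  ultimately show ?case using realizable_probs_series[OF Suc.IH assms(1)] by (simp only:)
qed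

lemma Z_simple_iff:
  "q \<in> Z_simple \<longleftrightarrow>
    (\<exists>(V :: nat set) E. simple_graph V E \<and> connected_graph V E \<and> reliability V E q = 0)"
proof -
  have "poly (rel_poly V E) q = reliability V E q" if "simple_graph V E" for V :: "nat set" and E
    by (rule poly_rel_poly[OF simple_graph_finite(2)[OF that]])
  then show ?thesis by (simp add: Z_simple_def cong: conj_cong)
qed

lemma one_in_Z_simple: "1 \<in> Z_simple"
proof -
  have "simple_graph {0, 1 :: nat} {{0, 1}}" by (auto simp: simple_graph_def)
  moreover have "reliability {0, 1 :: nat} {{0, 1}} 1 = (0 :: complex)"
    by (simp add: single_edge_probs)
  ultimately show ?thesis
    unfolding Z_simple_iff using connected_single_edge[of "0 :: nat" 1] by blast
qed

lemma cycle_of_bundles_root: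
  assumes "realizable_probs q c d" "k > 0" "N > 0" and root: "(c + d) ^ k + of_nat N * d ^ k = 0"
  shows "q \<in> Z_simple"
proof -
  define D where "D = d ^ k"
  define C where "C = (c + d) ^ k - D"
  have "realizable_probs q C D"
    unfolding C_def D_def by (rule realizable_probs_parallel_power[OF assms(1,2)])
  from realizable_probs_parallel[OF realizable_probs_series_power[OF this assms(3)] this]
  obtain V E where G: "simple_graph (V :: nat set) E" "connected_graph V E"
    and rel: "reliability V E q = C ^ N * C + C ^ N * D + of_nat N * C ^ (N - 1) * D * C"
    by (auto simp: realizable_probs_def two_terminal_graph_def)
  have "C ^ N * C + C ^ N * D + of_nat N * C ^ (N - 1) * D * C = C ^ N * (C + D + of_nat N * D)"
    using assms(3) by (cases N) (simp_all add: algebra_simps)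
  also have "C + D + of_nat N * D = 0" using root by (simp add: C_def D_def)
  finally show ?thesis using G rel by (auto simp: Z_simple_iff)
qed

subsection \<open>Complete graphs\<close>

definition complete_edges :: "'a set \<Rightarrow> 'a set set" where
  "complete_edges V = {e. e \<subseteq> V \<and> card e = 2}"

lemma simple_graph_complete: "finite V \<Longrightarrow> simple_graph V (complete_edges V)"
  by (auto simp: simple_graph_def complete_edges_def)

lemma connected_graph_complete:
  assumes "V \<noteq> {}"
  shows "connected_graph V (complete_edges V)"
  unfolding connected_graph_def
proof (intro conjI ballI)
  fix u v assume "u \<in> V" "v \<in> V"
  then show "(u, v) \<in> {(x, y). {x, y} \<in> complete_edges V}\<^sup>*"
    by (cases "u = v") (auto simp: complete_edges_def intro!: r_into_rtrancl)
qed (rule assms)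

lemma complete_edges_Int_Pow: "A \<subseteq> V \<Longrightarrow> complete_edges V \<inter> Pow A = complete_edges A"
  by (auto simp: complete_edges_def)

lemma complete_edges_image:
  assumes "inj_on f V"
  shows "complete_edges (f ` V) = (`) f ` complete_edges V"
proof -
  have "card (f ` e) = card e" if "e \<subseteq> V" for e
    using card_image[OF inj_on_subset[OF assms that]] .
  then show ?thesis by (auto simp: complete_edges_def subset_image_iff)
qed

lemma card_edges_between_complete:
  assumes "A \<subseteq> V"
  shows "card (edges_between (complete_edges V) A (V - A)) = card A * card (V - A)"
proof -
  have "edges_between (complete_edges V) A (V - A) = (\<lambda>(a, b). {a, b}) ` (A \<times> (V - A))"
    using assms by (auto simp: edges_between_def complete_edges_def card_insert_if)
  moreover have "inj_on (\<lambda>(a, b). {a, b}) (A \<times> (V - A))"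
    by (auto simp: inj_on_def doubleton_eq_iff)
  ultimately show ?thesis by (simp add: card_image card_cartesian_product)
qed

definition clique_rel :: "nat \<Rightarrow> 'b::comm_ring_1 \<Rightarrow> 'b" where
  "clique_rel m q = reliability {..<m} (complete_edges {..<m}) q"

definition clique_split :: "nat \<Rightarrow> 'b::comm_ring_1 \<Rightarrow> 'b" where
  "clique_split m q = split_prob {..<m} 0 1 (complete_edges {..<m}) q"

lemma clique_rel_0: "clique_rel 0 q = 0"
  by (simp add: clique_rel_def subset_prob_def connected_graph_def)

lemma reliability_complete:
  assumes "finite V"
  shows "reliability V (complete_edges V) q = clique_rel (card V) q"
proof -
  obtain f where f: "inj_on f {..<card V}" "f ` {..<card V} = V"
    using ex_bij_betw_nat_finite[OF assms] by (auto simp: bij_betw_def atLeast0LessThan)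
  have "complete_edges {..<card V} \<subseteq> Pow {..<card V}" by (auto simp: complete_edges_def)
  then show ?thesis
    using probs_image(1)[OF f(1)] f(2) by (metis clique_rel_def complete_edges_image[OF f(1)])
qed

lemma clique_rel_sum:
  assumes "finite V" "r \<in> V"
  shows "(\<Sum>A | r \<in> A \<and> A \<subseteq> V. clique_rel (card A) q * q ^ (card A * card (V - A))) = 1"
proof -
  have "clique_rel (card A) q * q ^ (card A * card (V - A)) =
      reliability A (complete_edges V \<inter> Pow A) q *
        q ^ card (edges_between (complete_edges V) A (V - A))"
    if "A \<subseteq> V" for A
    using that finite_subset[OF that assms(1)]
    by (simp add: complete_edges_Int_Pow reliability_complete card_edges_between_complete)
  then show ?thesis
    using component_prob_sum[OF simple_graph_complete[OF assms(1)] assms(2), of q] by simp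
qed

lemma clique_split_sum:
  assumes m: "m \<ge> 2"
  shows "clique_split m q = (\<Sum>A | 0 \<in> A \<and> A \<subseteq> {..<m} - {1}.
    clique_rel (card A) q * q ^ (card A * card ({..<m} - A)) * clique_rel (card ({..<m} - A)) q)"
proof -
  let ?V = "{..<m}" and ?E = "complete_edges {..<m}"
  have "clique_split m q = (\<Sum>A | 0 \<in> A \<and> A \<subseteq> ?V - {1}.
      reliability A (?E \<inter> Pow A) q * q ^ card (edges_between ?E A (?V - A)) *
        reliability (?V - A) (?E \<inter> Pow (?V - A)) q)"
    unfolding clique_split_def using m
    by (intro split_prob_component_sum simple_graph_complete) auto
  also have "\<dots> = (\<Sum>A | 0 \<in> A \<and> A \<subseteq> ?V - {1}.
    clique_rel (card A) q * q ^ (card A * card (?V - A)) * clique_rel (card (?V - A)) q)"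
  proof (rule sum.cong[OF refl])
    fix A assume "A \<in> {A. 0 \<in> A \<and> A \<subseteq> ?V - {1}}"
    then have "A \<subseteq> ?V" by auto
    then show "reliability A (?E \<inter> Pow A) q * q ^ card (edges_between ?E A (?V - A)) *
          reliability (?V - A) (?E \<inter> Pow (?V - A)) q =
        clique_rel (card A) q * q ^ (card A * card (?V - A)) * clique_rel (card (?V - A)) q"
      using finite_subset[of A ?V]
      by (simp add: complete_edges_Int_Pow reliability_complete card_edges_between_complete)
  qed
  finally show ?thesis .
qed

subsection \<open>Large cliques behave like single vertices\<close>

definition cut_bound :: "real \<Rightarrow> nat \<Rightarrow> real" where
  "cut_bound \<rho> m = 2 * ((1 + sqrt \<rho> ^ m) ^ m - 1)"

lemma cut_bound_nonneg: "0 \<le> \<rho> \<Longrightarrow> 0 \<le> cut_bound \<rho> m"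
  by (simp add: cut_bound_def)

lemma cut_bound_tendsto_0:
  assumes "0 \<le> \<rho>" "\<rho> < 1"
  shows "cut_bound \<rho> \<longlonglongrightarrow> 0"
proof -
  define \<sigma> where "\<sigma> = sqrt \<rho>"
  have \<sigma>: "0 \<le> \<sigma>" "\<sigma> < 1" using assms by (simp_all add: \<sigma>_def)
  then have "(\<lambda>m. real m * \<sigma> ^ m) \<longlonglongrightarrow> 0" by (intro powser_times_n_limit_0) auto
  then have "(\<lambda>m. 2 * (exp (real m * \<sigma> ^ m) - 1)) \<longlonglongrightarrow> 2 * (exp 0 - 1)"
    by (intro tendsto_intros)
  then have lim: "(\<lambda>m. 2 * (exp (real m * \<sigma> ^ m) - 1)) \<longlonglongrightarrow> 0" by simp
  have "(1 + \<sigma> ^ m) ^ m \<le> exp (\<sigma> ^ m) ^ m" for m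
    using \<sigma> by (intro power_mono exp_ge_add_one_self) auto
  then have "cut_bound \<rho> m \<le> 2 * (exp (real m * \<sigma> ^ m) - 1)" for m
    by (simp add: cut_bound_def \<sigma>_def exp_of_nat_mult)
  then show ?thesis
    using cut_bound_nonneg[OF assms(1)] by (intro tendsto_sandwich[OF _ _ tendsto_const lim]) auto
qed

text \<open>Since \<open>2 a b \<ge> (a + b) min a b\<close>, a cut with sides of sizes \<open>a\<close> and \<open>b\<close> contributes at most
  \<open>t ^ a + t ^ b\<close> with \<open>t = sqrt \<rho> ^ (a + b)\<close>.\<close>

lemma power_mult_le_sqrt_power:
  fixes \<rho> :: real
  assumes "0 \<le> \<rho>" "\<rho> \<le> 1"
  shows "\<rho> ^ (a * b) \<le> (sqrt \<rho> ^ (a + b)) ^ a + (sqrt \<rho> ^ (a + b)) ^ b"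
proof -
  define t where "t = sqrt \<rho> ^ (a + b)"
  have t: "0 \<le> t" using assms by (simp add: t_def)
  have "(a + b) * min a b \<le> 2 * (a * b)"
    using mult_le_mono1[of a b a] mult_le_mono1[of b a b] by (auto simp: min_def algebra_simps)
  then have "sqrt \<rho> ^ (2 * (a * b)) \<le> sqrt \<rho> ^ ((a + b) * min a b)"
    using assms by (intro power_decreasing) auto
  also have "\<dots> = t ^ min a b" by (simp add: t_def power_mult)
  also have "\<dots> \<le> t ^ a + t ^ b" using t by (simp add: min_def)
  finally show ?thesis using assms(1) by (simp add: power_mult t_def)
qed

lemma proper_cut_sum_le:
  assumes \<rho>: "0 \<le> \<rho>" "\<rho> \<le> 1" and V: "finite V"
    and I: "I \<subseteq> {A. A \<subseteq> V \<and> A \<noteq> {} \<and> A \<noteq> V}"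
  shows "(\<Sum>A\<in>I. \<rho> ^ (card A * card (V - A))) \<le> cut_bound \<rho> (card V)"
proof -
  define t where "t = sqrt \<rho> ^ card V"
  have t: "0 \<le> t" using \<rho> by (simp add: t_def)
  have fin: "finite (Pow V - {{}})" "finite (Pow V - {V})" using V by auto
  have "(\<Sum>A\<in>Pow V. t ^ card A) = (1 + t) ^ card V"
    using sum_Pow_power[OF V, of t 1] by (simp add: add.commute)
  then have nonempty: "(\<Sum>A\<in>Pow V - {{}}. t ^ card A) = (1 + t) ^ card V - 1"
    using V by (simp add: sum_diff1)
  have proper: "(\<Sum>A\<in>Pow V - {V}. t ^ card (V - A)) = (\<Sum>A\<in>Pow V - {{}}. t ^ card A)"
    by (rule sum.reindex_bij_witness[where i = "\<lambda>A. V - A" and j = "\<lambda>A. V - A"]) auto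
  have "(\<Sum>A\<in>I. \<rho> ^ (card A * card (V - A))) \<le> (\<Sum>A\<in>I. t ^ card A + t ^ card (V - A))"
  proof (rule sum_mono)
    fix A assume "A \<in> I"
    then have "card V = card A + card (V - A)"
      using I V by (auto simp: card_Diff_subset card_mono finite_subset)
    then show "\<rho> ^ (card A * card (V - A)) \<le> t ^ card A + t ^ card (V - A)"
      using power_mult_le_sqrt_power[OF \<rho>] by (simp add: t_def)
  qed
  also have "\<dots> = (\<Sum>A\<in>I. t ^ card A) + (\<Sum>A\<in>I. t ^ card (V - A))" by (rule sum.distrib)
  also have "\<dots> \<le> (\<Sum>A\<in>Pow V - {{}}. t ^ card A) + (\<Sum>A\<in>Pow V - {V}. t ^ card (V - A))"
    using t I by (intro add_mono sum_mono2 fin) auto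
  also have "\<dots> = cut_bound \<rho> (card V)" unfolding proper nonempty by (simp add: cut_bound_def t_def)
  finally show ?thesis .
qed

lemma norm_power_le: "norm (x :: 'b::real_normed_field) \<le> r \<Longrightarrow> norm (x ^ n) \<le> r ^ n"
  by (simp add: norm_power power_mono)

lemma clique_rel_minus_one_le:
  fixes q :: "'b::real_normed_field"
  assumes q: "norm q \<le> \<rho>" "\<rho> \<le> 1" and m: "m > 0"
    and C: "0 \<le> C" "\<And>j. j < m \<Longrightarrow> norm (clique_rel j q) \<le> C"
  shows "norm (clique_rel m q - 1) \<le> C * cut_bound \<rho> m"
proof -
  let ?V = "{..<m}"
  let ?I = "{A. 0 \<in> A \<and> A \<subseteq> ?V} - {?V}"
  let ?f = "\<lambda>A. clique_rel (card A) q * q ^ (card A * card (?V - A))"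
  have \<rho>: "0 \<le> \<rho>" using q(1) norm_ge_zero order.trans by blast
  have "(\<Sum>A | 0 \<in> A \<and> A \<subseteq> ?V. ?f A) = ?f ?V + sum ?f ?I" using m by (intro sum.remove) auto
  also have "(\<Sum>A | 0 \<in> A \<and> A \<subseteq> ?V. ?f A) = 1" using m by (intro clique_rel_sum) auto
  finally have "clique_rel m q - 1 = - sum ?f ?I" by (simp add: algebra_simps)
  then have "norm (clique_rel m q - 1) = norm (sum ?f ?I)" by simp
  also have "\<dots> \<le> (\<Sum>A\<in>?I. C * \<rho> ^ (card A * card (?V - A)))"
  proof (rule sum_norm_le)
    fix A assume "A \<in> ?I"
    then have "card A < m" using psubset_card_mono[of ?V A] by auto
    then show "norm (?f A) \<le> C * \<rho> ^ (card A * card (?V - A))"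
      unfolding norm_mult using C q by (intro mult_mono norm_power_le) auto
  qed
  also have "\<dots> = C * (\<Sum>A\<in>?I. \<rho> ^ (card A * card (?V - A)))" by (simp add: sum_distrib_left)
  also have "\<dots> \<le> C * cut_bound \<rho> (card ?V)"
    using q \<rho> C(1) by (intro mult_left_mono proper_cut_sum_le) auto
  finally show ?thesis by simp
qed

lemma clique_split_le:
  fixes q :: "'b::real_normed_field"
  assumes q: "norm q \<le> \<rho>" "\<rho> \<le> 1" and m: "m \<ge> 2" and C: "\<And>j. norm (clique_rel j q) \<le> C"
  shows "norm (clique_split m q) \<le> C * C * cut_bound \<rho> m"
proof -
  let ?V = "{..<m}"
  let ?I = "{A. 0 \<in> A \<and> A \<subseteq> ?V - {1}}"
  have nonneg: "0 \<le> \<rho>" "0 \<le> C" using q(1) C[of 0] norm_ge_zero order.trans by blast+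
  have "norm (clique_split m q) \<le> (\<Sum>A\<in>?I. C * \<rho> ^ (card A * card (?V - A)) * C)"
    unfolding clique_split_sum[OF m]
  proof (rule sum_norm_le)
    fix A
    show "norm (clique_rel (card A) q * q ^ (card A * card (?V - A)) * clique_rel (card (?V - A)) q)
        \<le> C * \<rho> ^ (card A * card (?V - A)) * C"
      unfolding norm_mult using C q nonneg by (intro mult_mono norm_power_le) auto
  qed
  also have "\<dots> = C * C * (\<Sum>A\<in>?I. \<rho> ^ (card A * card (?V - A)))"
    by (simp add: sum_distrib_left mult_ac)
  also have "\<dots> \<le> C * C * cut_bound \<rho> (card ?V)"
  proof (intro mult_left_mono proper_cut_sum_le)
    have "1 \<in> ?V" using m by simp
    then show "?I \<subseteq> {A. A \<subseteq> ?V \<and> A \<noteq> {} \<and> A \<noteq> ?V}" by blast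
  qed (use q nonneg in auto)
  finally show ?thesis by simp
qed

lemma recursive_bound_le_prod:
  fixes a b :: "nat \<Rightarrow> real"
  assumes b: "\<And>n. 0 \<le> b n" "\<And>n. N \<le> n \<Longrightarrow> b n \<le> 1 / 2"
    and rec: "\<And>n C. 0 \<le> C \<Longrightarrow> (\<And>j. j < n \<Longrightarrow> a j \<le> C) \<Longrightarrow> a n \<le> 1 + C * b n"
  shows "a n \<le> 2 * (\<Prod>j<N. 1 + b j)"
proof -
  define P where "P n = 2 * (\<Prod>j<n. 1 + b j)" for n
  have P_Suc: "P (Suc n) = P n * (1 + b n)" for n by (simp add: P_def)
  have P_ge: "2 \<le> P n" for n using prod_ge_1[of "{..<n}" "\<lambda>j. 1 + b j"] b(1) by (simp add: P_def)
  have "P n \<le> P (Suc n)" for n using P_ge[of n] b(1)[of n] by (simp add: P_Suc algebra_simps)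
  then have P_mono: "P m \<le> P n" if "m \<le> n" for m n using that by (rule lift_Suc_mono_le)
  have "a n \<le> P (min (Suc n) N)"
  proof (induction n rule: less_induct)
    case (less n)
    let ?C = "P (min n N)"
    have "a j \<le> ?C" if "j < n" for j
      using less[OF that] P_mono[of "min (Suc j) N" "min n N"] that by linarith
    then have an: "a n \<le> 1 + ?C * b n" using P_ge[of "min n N"] by (intro rec) auto
    show ?case
    proof (cases "n < N")
      case True
      then show ?thesis using an P_ge[of n] by (simp add: P_Suc algebra_simps)
    next
      case False
      then have mins: "min n N = N" "min (Suc n) N = N" by simp_all
      have "P N * b n \<le> P N * (1 / 2)"
        using False b(2)[of n] P_ge[of N] by (intro mult_left_mono) auto
      then show ?thesis using an P_ge[of N] unfolding mins by linarith
    qed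
  qed
  also have "\<dots> \<le> P N" by (rule P_mono) simp
  finally show ?thesis by (simp add: P_def)
qed

lemma clique_rel_bounded:
  assumes "0 \<le> \<rho>" "\<rho> < 1"
  obtains M where "M \<ge> 0" "\<And>(q :: 'b::real_normed_field) m. norm q \<le> \<rho> \<Longrightarrow> norm (clique_rel m q) \<le> M"
proof -
  let ?b = "cut_bound \<rho>"
  have b_nonneg: "0 \<le> ?b n" for n by (rule cut_bound_nonneg[OF assms(1)])
  have "\<forall>\<^sub>F n in sequentially. ?b n < 1 / 2"
    by (rule order_tendstoD(2)[OF cut_bound_tendsto_0[OF assms]]) simp
  then obtain N where small: "\<And>n. N \<le> n \<Longrightarrow> ?b n \<le> 1 / 2"
    by (force simp: eventually_sequentially)
  have "norm (clique_rel m q) \<le> 2 * (\<Prod>j<N. 1 + ?b j)" if q: "norm q \<le> \<rho>" for q :: 'b and m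
  proof (rule recursive_bound_le_prod[OF b_nonneg small])
    fix n C assume C: "0 \<le> C" "\<And>j. j < n \<Longrightarrow> norm (clique_rel j q) \<le> C"
    show "norm (clique_rel n q) \<le> 1 + C * ?b n"
    proof (cases "n = 0")
      case False
      then show ?thesis
        using clique_rel_minus_one_le[of q \<rho> n C] C q assms(2)
          norm_triangle_ineq2[of "clique_rel n q" 1] by simp
    qed (use C(1) b_nonneg in \<open>simp add: clique_rel_0\<close>)
  qed
  moreover have "0 \<le> 2 * (\<Prod>j<N. 1 + ?b j)" using b_nonneg by (simp add: prod_nonneg)
  ultimately show ?thesis using that by blast
qed

subsection \<open>Density of the roots\<close>

text \<open>A factor of the reliability of a cycle of \<open>N + 1\<close> bundles of \<open>k\<close> parallel gadgets, each a
  clique of size \<open>m\<close> with a pendant edge at one terminal.\<close>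

definition cycle_factor :: "nat \<Rightarrow> nat \<Rightarrow> nat \<Rightarrow> 'b::comm_ring_1 \<Rightarrow> 'b" where
  "cycle_factor k N m q = (clique_rel m q + (1 - q) * clique_split m q) ^ k
    + of_nat N * (q * clique_rel m q + (1 - q) * clique_split m q) ^ k"

lemma cycle_factor_root:
  assumes "m \<ge> 2" "k > 0" "N > 0" and root: "cycle_factor k N m q = 0"
  shows "q \<in> Z_simple"
proof (rule cycle_of_bundles_root[OF _ assms(2,3)])
  show "realizable_probs q ((1 - q) * clique_rel m q)
      ((1 - q) * clique_split m q + q * clique_rel m q)"
    unfolding clique_rel_def clique_split_def using assms(1)
    by (intro realizable_probs_pendant_edge simple_graph_complete connected_graph_complete)
      (auto simp: lessThan_empty_iff)
  show "((1 - q) * clique_rel m q + ((1 - q) * clique_split m q + q * clique_rel m q)) ^ k +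
      of_nat N * ((1 - q) * clique_split m q + q * clique_rel m q) ^ k = 0"
    using root by (simp add: cycle_factor_def algebra_simps)
qed

lemma cycle_factor_of_real:
  "cycle_factor k N m (of_real x :: 'b::{real_algebra_1, comm_ring_1}) =
    of_real (cycle_factor k N m x)"
  by (simp add: cycle_factor_def clique_rel_def clique_split_def subset_prob_of_real)

lemma cycle_factor_holomorphic: "cycle_factor k N m holomorphic_on S"
  unfolding cycle_factor_def clique_rel_def clique_split_def subset_prob_def
  by (intro holomorphic_intros)

lemma cycle_factor_continuous: "continuous_on S (cycle_factor k N m :: real \<Rightarrow> real)"
  unfolding cycle_factor_def clique_rel_def clique_split_def subset_prob_def
  by (intro continuous_intros)

lemma uniform_limit_dominated:
  fixes f :: "'i \<Rightarrow> 'x \<Rightarrow> 'b::real_normed_vector"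
  assumes "(b \<longlongrightarrow> 0) F" "\<forall>\<^sub>F i in F. \<forall>x\<in>A. norm (f i x - g x) \<le> b i"
  shows "uniform_limit A f g F"
proof (rule uniform_limitI)
  fix e :: real assume "e > 0"
  then have "\<forall>\<^sub>F i in F. b i < e" using order_tendstoD(2)[OF assms(1)] by simp
  with assms(2) show "\<forall>\<^sub>F i in F. \<forall>x\<in>A. dist (f i x) (g x) < e"
    by eventually_elim (force simp: dist_norm)
qed

lemma uniform_limit_power:
  fixes f :: "'i \<Rightarrow> 'x \<Rightarrow> 'b::real_normed_field"
  assumes f: "uniform_limit A f g F" and g: "bounded (g ` A)"
  shows "uniform_limit A (\<lambda>i x. f i x ^ k) (\<lambda>x. g x ^ k) F"
proof (induction k)
  case 0
  show ?case by (simp add: uniform_limit_const)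
next
  case (Suc k)
  obtain B where B: "\<And>x. x \<in> A \<Longrightarrow> norm (g x) \<le> B" using g by (auto simp: bounded_iff)
  then have "bounded ((\<lambda>x. g x ^ k) ` A)"
    unfolding bounded_iff by (intro exI[of _ "B ^ k"]) (auto intro: norm_power_le)
  then have "uniform_limit A (\<lambda>i x. f i x * f i x ^ k) (\<lambda>x. g x * g x ^ k) F"
    by (intro uniform_lim_mult f g Suc)
  then show ?case by simp
qed

lemma clique_gadget_limit:
  fixes p :: "'b::real_normed_field \<Rightarrow> 'b"
  assumes \<rho>: "0 \<le> \<rho>" "\<rho> < 1" and p: "\<And>q. norm q \<le> \<rho> \<Longrightarrow> norm (p q) \<le> 1"
  shows "uniform_limit (cball 0 \<rho>)
    (\<lambda>m q. p q * clique_rel m q + (1 - q) * clique_split m q) p sequentially"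
proof -
  obtain M where M: "M \<ge> 0" "\<And>(q :: 'b) m. norm q \<le> \<rho> \<Longrightarrow> norm (clique_rel m q) \<le> M"
    using clique_rel_bounded[OF \<rho>] by blast
  have bound: "norm (p q * clique_rel m q + (1 - q) * clique_split m q - p q) \<le>
      (M + 2 * (M * M)) * cut_bound \<rho> m" if "m \<ge> 2" and q: "norm q \<le> \<rho>" for m q
  proof -
    have "norm (clique_rel m q - 1) \<le> M * cut_bound \<rho> m"
      using that M \<rho> by (intro clique_rel_minus_one_le) auto
    then have rel: "norm (p q * (clique_rel m q - 1)) \<le> 1 * (M * cut_bound \<rho> m)"
      unfolding norm_mult using p[OF q] by (intro mult_mono) auto
    have "norm (clique_split m q) \<le> M * M * cut_bound \<rho> m"
      using that M \<rho> by (intro clique_split_le) auto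
    then have split: "norm ((1 - q) * clique_split m q) \<le> 2 * (M * M * cut_bound \<rho> m)"
      unfolding norm_mult using norm_triangle_ineq4[of 1 q] q \<rho> by (intro mult_mono) auto
    have "p q * clique_rel m q + (1 - q) * clique_split m q - p q =
        p q * (clique_rel m q - 1) + (1 - q) * clique_split m q"
      by (simp add: algebra_simps)
    also have "norm \<dots> \<le> 1 * (M * cut_bound \<rho> m) + 2 * (M * M * cut_bound \<rho> m)"
      by (intro norm_triangle_le add_mono rel split)
    also have "\<dots> = (M + 2 * (M * M)) * cut_bound \<rho> m" by (simp add: algebra_simps)
    finally show ?thesis .
  qed
  show ?thesis
  proof (rule uniform_limit_dominated)
    show "(\<lambda>m. (M + 2 * (M * M)) * cut_bound \<rho> m) \<longlonglongrightarrow> 0"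
      by (intro tendsto_mult_right_zero cut_bound_tendsto_0[OF \<rho>])
    show "\<forall>\<^sub>F m in sequentially. \<forall>q\<in>cball 0 \<rho>. norm (p q * clique_rel m q +
        (1 - q) * clique_split m q - p q) \<le> (M + 2 * (M * M)) * cut_bound \<rho> m"
      using eventually_ge_at_top[of 2] by eventually_elim (simp add: bound)
  qed
qed

lemma cycle_factor_limit:
  assumes \<rho>: "0 \<le> \<rho>" "\<rho> < 1"
  shows "uniform_limit (cball (0 :: 'b::real_normed_field) \<rho>)
    (cycle_factor k N) (\<lambda>q. 1 + of_nat N * q ^ k) sequentially"
proof -
  let ?D = "cball (0 :: 'b) \<rho>"
  let ?f = "\<lambda>p m q. p q * clique_rel m q + (1 - q) * clique_split m q"
  have "uniform_limit ?D (?f (\<lambda>q. 1)) (\<lambda>q. 1) sequentially"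
    "uniform_limit ?D (?f (\<lambda>q. q)) (\<lambda>q. q) sequentially"
    using \<rho> by (intro clique_gadget_limit; simp)+
  moreover have "bounded ((\<lambda>q. 1 :: 'b) ` ?D)" "bounded ((\<lambda>q. q) ` ?D)"
    by (rule bounded_subset[of "{1}"]) auto
  ultimately have "uniform_limit ?D (cycle_factor k N) (\<lambda>q. 1 ^ k + of_nat N * q ^ k) sequentially"
    unfolding cycle_factor_def mult_1
    by (intro uniform_limit_add uniform_limit_power
        bounded_linear.uniform_limit[OF bounded_linear_mult_right])
  then show ?thesis by simp
qed

lemma nth_root_near_one:
  fixes e :: real
  assumes "e > 0"
  shows "\<exists>K. \<forall>k (u :: complex). K \<le> k \<longrightarrow> 1 / 2 \<le> norm u \<longrightarrow> norm u \<le> 1 \<longrightarrow>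
    (\<exists>z. z ^ k = u \<and> norm z \<le> 1 \<and> norm (z - 1) < e)"
proof -
  define C where "C = ln 2 + pi"
  have "isCont exp (0 :: complex)" by simp
  then obtain \<delta> where \<delta>: "\<delta> > 0" "\<And>z :: complex. norm z < \<delta> \<Longrightarrow> norm (exp z - 1) < e"
    using assms unfolding continuous_at_eps_delta by (auto simp: dist_norm)
  obtain j :: nat where j: "C / \<delta> < real j" using reals_Archimedean2 by blast
  show ?thesis
  proof (intro exI[of _ "Suc j"] allI impI)
    fix k and u :: complex assume k: "Suc j \<le> k" and u: "1 / 2 \<le> norm u" "norm u \<le> 1"
    then have u0: "u \<noteq> 0" by auto
    define z where "z = Ln u / of_nat k"
    have "- ln 2 \<le> ln (norm u)" "ln (norm u) \<le> 0"
      using u u0 ln_mono[of "1 / 2" "norm u"] by (simp_all add: ln_div)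
    then have "norm (Ln u) \<le> C"
      using cmod_le[of "Ln u"] u0 mpi_less_Im_Ln[OF u0] Im_Ln_le_pi[OF u0] by (simp add: C_def)
    moreover have "C / \<delta> < real k" using j k by linarith
    then have "C < \<delta> * real k" using \<delta>(1) by (simp add: field_simps)
    ultimately have "norm z < \<delta>" using k by (simp add: z_def norm_divide field_simps)
    then have "norm (exp z - 1) < e" by (rule \<delta>(2))
    moreover have "exp z ^ k = u"
      using k u0 by (simp add: z_def flip: exp_of_nat_mult)
    moreover have "norm (exp z) \<le> 1" using u u0 by (simp add: z_def divide_le_0_iff)
    ultimately show "\<exists>z. z ^ k = u \<and> norm z \<le> 1 \<and> norm (z - 1) < e" by blast
  qed
qed

lemma model_root_near:
  fixes q0 :: complex
  assumes q0: "q0 \<noteq> 0" "norm q0 < 1" and e: "e > 0"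
  obtains k N q1 where "odd k" "N > 0" "of_nat N * q1 ^ k = - 1" "norm q1 < 1" "dist q1 q0 < e"
proof -
  obtain K where K: "\<And>k (u :: complex). K \<le> k \<Longrightarrow> 1 / 2 \<le> norm u \<Longrightarrow> norm u \<le> 1 \<Longrightarrow>
      \<exists>z. z ^ k = u \<and> norm z \<le> 1 \<and> norm (z - 1) < e"
    using nth_root_near_one[OF e] by blast
  define k where "k = 2 * K + 1"
  define x where "x = 1 / norm q0 ^ k"
  have x1: "x \<ge> 1" using q0 power_le_one[of "norm q0" k] by (simp add: x_def)
  define N where "N = nat \<lceil>x\<rceil>"
  have N: "x \<le> real N" "real N \<le> 2 * x" "N > 0" using x1 unfolding N_def by linarith+
  define u where "u = - 1 / (of_nat N * q0 ^ k)"
  have norm_u: "norm u = x / real N" by (simp add: u_def x_def norm_divide norm_mult norm_power)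
  have "1 / 2 \<le> norm u" "norm u \<le> 1" unfolding norm_u using N x1 by (simp_all add: field_simps)
  then obtain z where z: "z ^ k = u" "norm z \<le> 1" "norm (z - 1) < e"
    using K[of k u] by (auto simp: k_def)
  show ?thesis
  proof (rule that[of k N "q0 * z"])
    show "of_nat N * (q0 * z) ^ k = - 1"
      using q0(1) N(3) z(1) by (simp add: power_mult_distrib u_def)
    show "norm (q0 * z) < 1"
      using q0(2) z(2) mult_left_mono[OF z(2), of "norm q0"] by (simp add: norm_mult)
    have "dist (q0 * z) q0 = norm q0 * norm (z - 1)"
      by (simp add: dist_norm algebra_simps flip: norm_mult)
    also have "\<dots> \<le> 1 * norm (z - 1)" using q0(2) by (intro mult_right_mono) auto
    finally show "dist (q0 * z) q0 < e" using z(3) by simp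
  qed (use N(3) in \<open>simp_all add: k_def\<close>)
qed

lemma one_plus_mult_power_not_constant_on:
  fixes q :: complex
  assumes "k > 0" "N > 0" "q \<noteq> 0" "open S" "q \<in> S"
  shows "\<not> (\<lambda>q. 1 + of_nat N * q ^ k) constant_on S"
proof
  let ?g = "\<lambda>q :: complex. 1 + of_nat N * q ^ k"
  assume "?g constant_on S"
  then obtain c where const: "\<And>z. z \<in> S \<Longrightarrow> c = ?g z" by (auto simp: constant_on_def)
  have "(?g has_field_derivative 0) (at q)"
    by (rule has_field_derivative_transform_within_open[OF DERIV_const assms(4,5) const])
  moreover have "(?g has_field_derivative of_nat N * (of_nat k * q ^ (k - 1))) (at q)"
    by (auto intro!: derivative_eq_intros)
  ultimately have "of_nat N * (of_nat k * q ^ (k - 1)) = 0" by (rule DERIV_unique[symmetric])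
  then show False using assms(1-3) by simp
qed

lemma complex_root_near:
  fixes q1 :: complex
  assumes kN: "k > 0" "N > 0" and q1: "of_nat N * q1 ^ k = - 1" "norm q1 < 1" and e: "e > 0"
  shows "\<exists>q\<in>Z_simple. dist q q1 < e"
proof (rule ccontr)
  assume no_root: "\<not> ?thesis"
  have q1_nz: "q1 \<noteq> 0" using q1(1) kN by (auto simp: zero_power)
  define \<rho> where "\<rho> = (1 + norm q1) / 2"
  have \<rho>: "0 \<le> \<rho>" "\<rho> < 1" using q1(2) by (simp_all add: \<rho>_def)
  define \<delta> where "\<delta> = min e (\<rho> - norm q1)"
  have \<delta>: "0 < \<delta>" "\<delta> \<le> e" "norm q1 + \<delta> \<le> \<rho>"
    using e q1(2) by (auto simp: \<delta>_def \<rho>_def min_def field_simps)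
  have sub: "ball q1 \<delta> \<subseteq> cball 0 \<rho>"
    using \<delta>(3) by (auto simp: ball_subset_cball_iff)
  let ?g = "\<lambda>q :: complex. 1 + of_nat N * q ^ k"
  let ?F = "\<lambda>m. cycle_factor k N (m + 2) :: complex \<Rightarrow> complex"
  have lim: "uniform_limit (cball 0 \<rho>) ?F ?g sequentially"
    using cycle_factor_limit[OF \<rho>] filterlim_add_const_nat_at_top by (rule filterlim_compose)
  have "?g q1 \<noteq> 0"
  proof (rule Hurwitz_no_zeros[of "ball q1 \<delta>" ?F ?g])
    show "?F m holomorphic_on ball q1 \<delta>" for m by (rule cycle_factor_holomorphic)
    show "?g holomorphic_on ball q1 \<delta>" by (intro holomorphic_intros)
    show "uniform_limit K ?F ?g sequentially" if "compact K" "K \<subseteq> ball q1 \<delta>" for K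
      using lim that(2) sub by (meson uniform_limit_on_subset order.trans)
    show "\<not> ?g constant_on ball q1 \<delta>"
      using kN q1_nz \<delta>(1) by (intro one_plus_mult_power_not_constant_on[of _ _ q1]) auto
    show "?F m z \<noteq> 0" if "z \<in> ball q1 \<delta>" for m z
    proof
      assume "?F m z = 0"
      then have "z \<in> Z_simple" using kN by (intro cycle_factor_root[of "m + 2" k N]) auto
      then show False using no_root that \<delta>(2) by (auto simp: dist_commute)
    qed
  qed (use \<delta>(1) in auto)
  then show False using q1(1) by simp
qed

lemma eventually_zero_of_sign_change:
  fixes f :: "nat \<Rightarrow> real \<Rightarrow> real"
  assumes "a \<le> b" "\<And>m. continuous_on {a..b} (f m)"
    and "(\<lambda>m. f m a) \<longlonglongrightarrow> l" "l < 0" and "(\<lambda>m. f m b) \<longlonglongrightarrow> u" "0 < u"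
  shows "\<forall>\<^sub>F m in sequentially. \<exists>y\<in>{a..b}. f m y = 0"
  using order_tendstoD(2)[OF assms(3,4)] order_tendstoD(1)[OF assms(5,6)]
proof eventually_elim
  case (elim m)
  then show ?case using IVT'[of "f m" a 0 b] assms(1,2) by auto
qed

lemma real_root_near:
  fixes x :: real
  assumes k: "odd k" and N: "N > 0" and x: "real N * x ^ k = - 1" "\<bar>x\<bar> < 1" and e: "e > 0"
  shows "\<exists>y. complex_of_real y \<in> Z_simple \<and> \<bar>y - x\<bar> < e"
proof -
  define \<rho> where "\<rho> = (1 + \<bar>x\<bar>) / 2"
  have \<rho>: "0 \<le> \<rho>" "\<rho> < 1" using x(2) by (simp_all add: \<rho>_def)
  define \<delta> where "\<delta> = min (e / 2) (\<rho> - \<bar>x\<bar>)"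
  have \<delta>: "0 < \<delta>" "\<delta> < e" "\<bar>x\<bar> + \<delta> \<le> \<rho>"
    using e x(2) by (auto simp: \<delta>_def \<rho>_def min_def field_simps)
  let ?g = "\<lambda>y :: real. 1 + real N * y ^ k"
  have lim: "(\<lambda>m. cycle_factor k N m y) \<longlonglongrightarrow> ?g y" if "\<bar>y\<bar> \<le> \<rho>" for y
    using tendsto_uniform_limitI[OF cycle_factor_limit[OF \<rho>, of k N], of y] that by simp
  have mono: "a ^ k < b ^ k" if "a < b" for a b :: real
    using that power_mono_odd[OF k, of a b] odd_real_root_power_cancel[OF k]
    by (metis order.order_iff_strict less_irrefl)
  have "real N * (x - \<delta>) ^ k < real N * x ^ k" "real N * x ^ k < real N * (x + \<delta>) ^ k"
    using mono \<delta>(1) N by simp_all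
  then have neg: "?g (x - \<delta>) < 0" and pos: "0 < ?g (x + \<delta>)" using x(1) by linarith+
  have "\<forall>\<^sub>F m in sequentially. \<exists>y\<in>{x - \<delta>..x + \<delta>}. cycle_factor k N m y = 0"
    using \<delta>
    by (intro eventually_zero_of_sign_change[OF _ _ lim neg lim pos] cycle_factor_continuous) auto
  then have "\<forall>\<^sub>F m in sequentially. m \<ge> 2 \<and> (\<exists>y\<in>{x - \<delta>..x + \<delta>}. cycle_factor k N m y = 0)"
    by (intro eventually_conj eventually_ge_at_top)
  then obtain m y where m: "m \<ge> 2" and y: "y \<in> {x - \<delta>..x + \<delta>}" "cycle_factor k N m y = 0"
    by (auto simp: eventually_sequentially)
  have "cycle_factor k N m (complex_of_real y) = 0" using y(2) by (simp add: cycle_factor_of_real)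
  then have "complex_of_real y \<in> Z_simple" using m odd_pos[OF k] N by (intro cycle_factor_root)
  then show ?thesis using y(1) \<delta>(2) by (intro exI[of _ y]) auto
qed

lemma Z_simple_dense:
  assumes "q \<noteq> 0" "norm q < 1"
  shows "q \<in> closure Z_simple"
  unfolding closure_approachable
proof (intro allI impI)
  fix e :: real assume e: "e > 0"
  obtain k N q1 where q1: "odd k" "N > 0" "of_nat N * q1 ^ k = - 1" "norm q1 < 1"
      "dist q1 q < e / 2"
    using model_root_near[OF assms, of "e / 2"] e by auto
  then obtain z where z: "z \<in> Z_simple" "dist z q1 < e / 2"
    using complex_root_near[of k N q1 "e / 2"] e odd_pos by auto
  have "dist z q < e" using dist_triangle[of z q q1] z(2) q1(5) by simp
  then show "\<exists>y\<in>Z_simple. dist y q < e" using z(1) by blast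
qed

lemma Z_simple_real_dense:
  assumes "- 1 < x" "x < 0"
  shows "complex_of_real x \<in> closure (Z_simple \<inter> \<real>)"
  unfolding closure_approachable
proof (intro allI impI)
  fix e :: real assume e: "e > 0"
  obtain k N q1 where q1: "odd k" "N > 0" "of_nat N * q1 ^ k = - 1" "norm q1 < 1"
      "dist q1 (complex_of_real x) < e / 2"
    using model_root_near[of "complex_of_real x" "e / 2"] e assms by auto
  have "norm (of_nat N * q1 ^ k) = 1" using q1(3) by simp
  then have "real N * (- norm q1) ^ k = - 1" using q1(1) by (simp add: norm_mult norm_power)
  then obtain y where y: "complex_of_real y \<in> Z_simple" "\<bar>y - (- norm q1)\<bar> < e / 2"
    using real_root_near[of k N "- norm q1" "e / 2"] q1 e by auto
  have "\<bar>norm q1 + x\<bar> \<le> dist q1 (complex_of_real x)"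
    using norm_triangle_ineq3[of q1 "complex_of_real x"] assms by (simp add: dist_norm)
  then have "\<bar>y - x\<bar> < e" using q1(5) y(2) by linarith
  then have "dist (complex_of_real y) (complex_of_real x) < e"
    by (simp add: dist_of_real dist_real_def)
  then show "\<exists>z\<in>Z_simple \<inter> \<real>. dist z (complex_of_real x) < e"
    using y(1) by (intro bexI[of _ "complex_of_real y"]) auto
qed

lemma interval_subset_closure_real_roots: "complex_of_real ` {-1..0} \<subseteq> closure (Z_simple \<inter> \<real>)"
proof -
  have "complex_of_real ` closure {-1<..<0} \<subseteq> closure (complex_of_real ` {-1<..<0})"
    by (intro continuous_image_closure_subset[of UNIV] continuous_intros) auto
  also have "\<dots> \<subseteq> closure (Z_simple \<inter> \<real>)"
    using Z_simple_real_dense by (intro closure_minimal) auto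
  finally show ?thesis by simp
qed

lemma unit_disc_subset_closure_roots: "ball 0 1 \<subseteq> closure Z_simple"
proof
  fix q :: complex assume q: "q \<in> ball 0 1"
  have "complex_of_real 0 \<in> closure (Z_simple \<inter> \<real>)"
    by (intro subsetD[OF interval_subset_closure_real_roots] imageI) simp
  then have "0 \<in> closure Z_simple" using closure_mono[of "Z_simple \<inter> \<real>" Z_simple] by auto
  then show "q \<in> closure Z_simple" using q Z_simple_dense[of q] by (cases "q = 0") auto
qed

lemma real_roots_subset: "Z_simple \<inter> \<real> \<subseteq> complex_of_real ` ({-1..0} \<union> {1})"
proof
  fix q assume "q \<in> Z_simple \<inter> \<real>"
  then obtain x V E where x: "q = complex_of_real x"
    and G: "simple_graph (V :: nat set) E" "connected_graph V E"
    and "reliability V E (complex_of_real x) = 0"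
    by (auto simp: Z_simple_iff elim!: Reals_cases)
  then have "reliability V E x = 0" by (simp add: subset_prob_of_real)
  then show "q \<in> complex_of_real ` ({-1..0} \<union> {1})"
    using real_reliability_root_range[OF G] x by blast
qed

theorem theorem1p1:
  shows "closure (ball 0 1) \<subseteq> closure Z_simple
    \<and> (complex_of_real ` {-1..0} \<subseteq> closure (Z_simple \<inter> \<real>)
       \<and> closure (Z_simple \<inter> \<real>) = complex_of_real ` ({-1..0} \<union> {1}))"
proof (intro conjI equalityI)
  note interval = interval_subset_closure_real_roots
  show "complex_of_real ` {-1..0} \<subseteq> closure (Z_simple \<inter> \<real>)" by (rule interval)
  show "closure (ball 0 1) \<subseteq> closure Z_simple"
    using unit_disc_subset_closure_roots by (rule closure_minimal) simp
  have "compact (complex_of_real ` ({-1..0} \<union> {1}))"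
    by (intro compact_continuous_image continuous_intros) auto
  then show "closure (Z_simple \<inter> \<real>) \<subseteq> complex_of_real ` ({-1..0} \<union> {1})"
    using real_roots_subset by (intro closure_minimal compact_imp_closed)
  have "complex_of_real 1 \<in> closure (Z_simple \<inter> \<real>)"
    using one_in_Z_simple closure_subset[of "Z_simple \<inter> \<real>"] by auto
  then show "complex_of_real ` ({-1..0} \<union> {1}) \<subseteq> closure (Z_simple \<inter> \<real>)" using interval by auto
qed

end
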